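(* Let $n=p+q\ge2$ with $0<p<n$. Let $D$ be the Dirac operator of the flat torus $\mathbb T^{p,q}$ of signature $(p,q)$ with the trivial spin structure, as an unbounded operator in the Hilbert space $L^2(S)=L^2(\mathbb T^{p,q},\Delta_{p,q})$ with domain $C^\infty(\mathbb T^{p,q},\Delta_{p,q})$, and let $\bar D$ be its closure. Then the spectrum of $D$ is the whole complex plane: $$\sigma(D)=\sigma(\bar D)=\mathbb C=\sigma_c(\bar D)\cup\sigma_p(\bar D).$$ The point spectrum is $$\sigma_p(\bar D)=\sigma_p(D)=\{\pm\sqrt{\langle k,k\rangle_{p,q}}\;|\;k\in\mathbb Z^n\}.$$
   Context: $\langle x,y\rangle_{p,q}=-\sum_{i\le p}x_iy_i+\sum_{i>p}x_iy_i$ on $\mathbb R^n$; Clifford relation $x\cdot y+y\cdot x=-2\langle x,y\rangle_{p,q}$. Square roots of negative numbers are taken in $\mathbb C$. $\mathbb T^{p,q}=\mathbb R^n/(2\pi\mathbb Z^n)$ with the metric induced by $\langle\cdot,\cdot\rangle_{p,q}$. Let $m=[n/2]$ and $\Delta_{p,q}=\mathbb C^{2^m}$ with its standard Hermitian inner product $(\cdot,\cdot)_{\Delta_{p,q}}$. Clifford multiplication of $x\in\mathbb R^n$ on $\Delta_{p,q}$ is the linear extension of $e_j\mapsto\kappa_{p,q}(e_j)$, given by $m$-fold Kronecker products: for $j\le2m$, $\kappa_{p,q}(e_j)=\tau(j)\,E\otimes\dots\otimes E\otimes U_{\sigma(j)}\otimes T\otimes\dots\otimes T$ with $[(j-1)/2]$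 factors $T$, and if $n=2m+1$, $\kappa_{p,q}(e_{2m+1})=\tau(2m+1)\,\mathbf i\,T^{\otimes m}$. Here $E$ is the $2\times2$ identity, $U_1=\mathrm{diag}(\mathbf i,-\mathbf i)$, $U_2=\begin{pmatrix}0&\mathbf i\\ \mathbf i&0\end{pmatrix}$, $T=\begin{pmatrix}0&-\mathbf i\\ \mathbf i&0\end{pmatrix}$, $\tau(j)=\mathbf i$ if $j\le p$ and $1$ if $j>p$, $\sigma(j)=1$ for $j$ odd, $2$ for $j$ even. For the trivial spin structure $\mathbb T^{p,q}\times\mathrm{Spin}_0(p,q)$, spinor fields are functions $\psi\in C^\infty(\mathbb T^{p,q},\Delta_{p,q})$ and $$D\psi=\sum_{j=1}^n\kappa_j\,e_j\cdot\frac{\partial\psi}{\partial x^j},\qquad \kappa_j=\langle e_j,e_j\rangle_{p,q}.$$ The inner product in $L^2(\mathbb T^{p,q},\Delta_{p,q})$ is $(2\pi)^{-n}\int_{\mathbb T^{p,q}}(\psi_1(x),\psi_2(x))_{\Delta_{p,q}}dx$ (this belongs to the maximal time-like subbundle spanned by $e_1,\dots,e_p$). $D$ is closable. For an operator $A$ in a Hilbert space $H$ and $A_\lambda=\lambda \mathrm I-A$: $\lambda\in\sigma_p(A)$ iff $\ker A_\lambda\ne\{0\}$; $\lambda\in\sigma_r(A)$ iff $\ker A_\lambda=\{0\}$ and $\overline{\mathrm{ran} A_\lambda}\neq H$; $\lambda\in\sigma_c(A)$ iff $\ker A_\lambda=\{0\}$, $\overline{\mathrm{ran} A_\lambda}=H$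 and $A_\lambda^{-1}$ (on $\mathrm{ran}A_\lambda$) is unbounded; $\lambda\in\rho(A)$ iff $\ker A_\lambda=\{0\}$, $\overline{\mathrm{ran} A_\lambda}=H$ and $A_\lambda^{-1}$ is bounded. $\sigma(A)=\mathbb C\setminus\rho(A)$. *)

theory Defs
  imports "HOL-Analysis.Analysis"
begin

section \<open>Complex inner product spaces and unbounded operators\<close>

class complex_inner = real_inner +
  fixes scaleC :: "complex \<Rightarrow> 'a \<Rightarrow> 'a"
    and cinner :: "'a \<Rightarrow> 'a \<Rightarrow> complex"
  assumes scaleC_add_right: "scaleC c (x + y) = scaleC c x + scaleC c y"
    and scaleC_add_left: "scaleC (c + d) x = scaleC c x + scaleC d x"
    and scaleC_scaleC: "scaleC c (scaleC d x) = scaleC (c * d) x"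
    and scaleC_one: "scaleC 1 x = x"
    and scaleC_of_real: "scaleC (of_real r) x = scaleR r x"
    and cinner_commute: "cinner x y = cnj (cinner y x)"
    and cinner_add_left: "cinner (x + y) z = cinner x z + cinner y z"
    and cinner_scaleC_left: "cinner (scaleC c x) y = c * cinner x y"
    and inner_eq_Re_cinner: "inner x y = Re (cinner x y)"

text \<open>An unbounded operator is represented by its graph. The domain, the range, the inverse and the
  closure are the library's \<^const>\<open>Domain\<close>, \<^const>\<open>Range\<close>, \<^const>\<open>converse\<close> and
  \<^const>\<open>closure\<close> (in the product topology) of the graph; the closure of the graph is again
  the graph of an operator exactly for closable operators.\<close>

type_synonym 'h operator = "('h \<times> 'h) set"

definition resolvent_op :: "complex \<Rightarrow> 'h::complex_inner operator \<Rightarrow> 'h operator" where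
  "resolvent_op l A = {(x, scaleC l x - y) | x y. (x, y) \<in> A}"

definition ker_op :: "'h::complex_inner operator \<Rightarrow> 'h set" where
  "ker_op A = {x. (x, 0) \<in> A}"

definition bounded_op :: "'h::complex_inner operator \<Rightarrow> bool" where
  "bounded_op A \<longleftrightarrow> (\<exists>C. \<forall>(x, y) \<in> A. norm y \<le> C * norm x)"

definition point_spectrum :: "'h::complex_inner operator \<Rightarrow> complex set" where
  "point_spectrum A = {l. ker_op (resolvent_op l A) \<noteq> {0}}"

definition residual_spectrum :: "'h::complex_inner operator \<Rightarrow> complex set" where
  "residual_spectrum A = {l. ker_op (resolvent_op l A) = {0} \<and>
     closure (Range (resolvent_op l A)) \<noteq> UNIV}"

definition continuous_spectrum :: "'h::complex_inner operator \<Rightarrow> complex set" where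
  "continuous_spectrum A = {l. ker_op (resolvent_op l A) = {0} \<and>
     closure (Range (resolvent_op l A)) = UNIV \<and> \<not> bounded_op ((resolvent_op l A)\<inverse>)}"

definition resolvent_set :: "'h::complex_inner operator \<Rightarrow> complex set" where
  "resolvent_set A = {l. ker_op (resolvent_op l A) = {0} \<and>
     closure (Range (resolvent_op l A)) = UNIV \<and> bounded_op ((resolvent_op l A)\<inverse>)}"

definition spectrum :: "'h::complex_inner operator \<Rightarrow> complex set" where
  "spectrum A = - resolvent_set A"


section \<open>Clifford multiplication\<close>

text \<open>The dimension is \<open>n = CARD('n)\<close>. The linear order of \<open>'n\<close> numbers the coordinates:
  \<open>pos i\<close> is the usual index of \<open>i\<close> in \<open>{1..n}\<close>.\<close>

definition pos :: "'n::{finite,linorder} \<Rightarrow> nat" where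
  "pos i = card {k. k \<le> i}"

definition pq_form :: "nat \<Rightarrow> real^'n::{finite,linorder} \<Rightarrow> real^'n::{finite,linorder} \<Rightarrow> real" where
  "pq_form p x y = - (\<Sum>i | pos i \<le> p. x $ i * y $ i) + (\<Sum>i | pos i > p. x $ i * y $ i)"

text \<open>Matrices are indexed from 0 here, so that the Kronecker product is given by quotients and
  remainders of the indices.\<close>

type_synonym nmat = "nat \<Rightarrow> nat \<Rightarrow> complex"

fun mat2 :: "complex \<Rightarrow> complex \<Rightarrow> complex \<Rightarrow> complex \<Rightarrow> nmat" where
  "mat2 a b c d i j = (if i = 0 then (if j = 0 then a else b) else (if j = 0 then c else d))"

definition E_mat :: nmat where "E_mat = mat2 1 0 0 1"
definition U1_mat :: nmat where "U1_mat = mat2 \<i> 0 0 (- \<i>)"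
definition U2_mat :: nmat where "U2_mat = mat2 0 \<i> \<i> 0"
definition T_mat :: nmat where "T_mat = mat2 0 (- \<i>) \<i> 0"

text \<open>Kronecker product of a list of \<open>2\<times>2\<close> matrices; the first factor is the coarsest block level.\<close>

fun kronecker :: "nmat list \<Rightarrow> nmat" where
  "kronecker [] = (\<lambda>i j. 1)"
| "kronecker (A # As) = (\<lambda>i j.
     A (i div 2 ^ length As) (j div 2 ^ length As) *
     kronecker As (i mod 2 ^ length As) (j mod 2 ^ length As))"

definition tau :: "nat \<Rightarrow> nat \<Rightarrow> complex" where
  "tau p j = (if j \<le> p then \<i> else 1)"

definition kappa :: "nat \<Rightarrow> nat \<Rightarrow> nat \<Rightarrow> nmat" where
  "kappa m p j = (\<lambda>a b. tau p j *
     (if j \<le> 2 * m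
      then kronecker (replicate (m - 1 - (j - 1) div 2) E_mat @
                      [if odd j then U1_mat else U2_mat] @
                      replicate ((j - 1) div 2) T_mat) a b
      else \<i> * kronecker (replicate m T_mat) a b))"

text \<open>The index set of \<open>\<complex>\<close> to the power \<open>2^m\<close>, where \<open>m = CARD('n) div 2\<close>.\<close>

typedef 'n spin_index = "{..<2 ^ (CARD('n) div 2)} :: nat set"
  by (rule exI[of _ 0]) simp

instance spin_index :: (type) finite
proof
  have "range (Rep_spin_index :: 'a spin_index \<Rightarrow> nat) \<subseteq> {..<2 ^ (CARD('a) div 2)}"
    using Rep_spin_index by auto
  then have "finite (range (Rep_spin_index :: 'a spin_index \<Rightarrow> nat))"
    using finite_subset by blast
  then show "finite (UNIV :: 'a spin_index set)"
    by (rule finite_imageD) (simp add: inj_on_def Rep_spin_index_inject)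
qed

type_synonym 'n spinor = "complex ^ 'n spin_index"

definition gamma_mat :: "nat \<Rightarrow> 'n::{finite,linorder} \<Rightarrow> complex ^ 'n spin_index ^ 'n spin_index" where
  "gamma_mat p i = (\<chi> a b. kappa (CARD('n) div 2) p (pos i) (Rep_spin_index a) (Rep_spin_index b))"

definition clifford_mult :: "nat \<Rightarrow> real^'n::{finite,linorder} \<Rightarrow> 'n spinor \<Rightarrow> 'n spinor" where
  "clifford_mult p x v = (\<Sum>i\<in>UNIV. complex_of_real (x $ i) *s (gamma_mat p i *v v))"

definition spinor_cinner :: "'n spinor \<Rightarrow> 'n spinor \<Rightarrow> complex" where
  "spinor_cinner v w = (\<Sum>a\<in>UNIV. v $ a * cnj (w $ a))"


section \<open>Spinor fields on the torus\<close>

text \<open>Functions on the torus are \<open>2\<pi>\<close>-periodic functions on \<open>\<real>\<close> to the power \<open>n\<close>.\<close>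

definition periodic :: "(real^'n \<Rightarrow> 'b) \<Rightarrow> bool" where
  "periodic f \<longleftrightarrow> (\<forall>x k. (\<forall>i. k $ i \<in> \<int>) \<longrightarrow> f (x + (2 * pi) *\<^sub>R k) = f x)"

fun Ck :: "nat \<Rightarrow> ('a::real_normed_vector \<Rightarrow> 'b::real_normed_vector) \<Rightarrow> bool" where
  "Ck 0 f \<longleftrightarrow> continuous_on UNIV f"
| "Ck (Suc k) f \<longleftrightarrow> (\<forall>x. f differentiable at x) \<and>
     (\<forall>v. Ck k (\<lambda>x. frechet_derivative f (at x) v))"

definition smooth :: "('a::real_normed_vector \<Rightarrow> 'b::real_normed_vector) \<Rightarrow> bool" where
  "smooth f \<longleftrightarrow> (\<forall>k. Ck k f)"

definition smooth_spinors :: "(real^'n \<Rightarrow> 'n spinor) set" where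
  "smooth_spinors = {\<psi>. periodic \<psi> \<and> smooth \<psi>}"

definition dirac_diff :: "nat \<Rightarrow> (real^'n::{finite,linorder} \<Rightarrow> 'n spinor) \<Rightarrow>
    real^'n::{finite,linorder} \<Rightarrow> 'n spinor" where
  "dirac_diff p \<psi> x = (\<Sum>j\<in>UNIV. pq_form p (axis j 1) (axis j 1) *\<^sub>R
     clifford_mult p (axis j 1) (frechet_derivative \<psi> (at x) (axis j 1)))"

text \<open>Integration against \<open>torus_measure\<close> is the integral over the fundamental cell
  divided by its volume, the \<open>n\<close>-th power of \<open>2\<pi>\<close>.\<close>

definition torus_measure :: "(real^'n) measure" where
  "torus_measure = uniform_measure lborel (cbox 0 (\<chi> i. 2 * pi))"

definition square_integrable :: "(real^'n \<Rightarrow> 'n spinor) \<Rightarrow> bool" where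
  "square_integrable f \<longleftrightarrow> periodic f \<and> f \<in> borel_measurable borel \<and>
     integrable torus_measure (\<lambda>x. (norm (f x))\<^sup>2)"

lemma sets_torus_measure [simp, measurable_cong]: "sets torus_measure = sets borel"
  by (simp add: torus_measure_def)

lemma space_torus_measure [simp]: "space torus_measure = UNIV"
  by (simp add: torus_measure_def)

lemma square_integrable_zero: "square_integrable (\<lambda>_. 0)"
  by (simp add: square_integrable_def periodic_def)

lemma square_integrable_add:
  assumes "square_integrable f" "square_integrable g"
  shows "square_integrable (\<lambda>x. f x + g x)"
proof -
  have m [measurable]: "f \<in> borel_measurable borel" "g \<in> borel_measurable borel"
    using assms by (auto simp: square_integrable_def)
  have i: "integrable torus_measure (\<lambda>x. 2 * (norm (f x))\<^sup>2 + 2 * (norm (g x))\<^sup>2)"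
    using assms by (auto simp: square_integrable_def)
  have "(norm (f x + g x))\<^sup>2 \<le> 2 * (norm (f x))\<^sup>2 + 2 * (norm (g x))\<^sup>2" for x
  proof -
    have "(norm (f x + g x))\<^sup>2 \<le> (norm (f x) + norm (g x))\<^sup>2"
      by (simp add: norm_triangle_ineq power_mono)
    also have "\<dots> \<le> 2 * (norm (f x))\<^sup>2 + 2 * (norm (g x))\<^sup>2"
      using sum_squares_bound[of "norm (f x)" "norm (g x)"] by (simp add: power2_sum)
    finally show ?thesis .
  qed
  then have "integrable torus_measure (\<lambda>x. (norm (f x + g x))\<^sup>2)"
    by (intro Bochner_Integration.integrable_bound[OF i]) auto
  then show ?thesis
    using assms by (auto simp: square_integrable_def periodic_def)
qed

lemma norm_smult_spinor: "norm (c *s v) = cmod c * norm (v :: complex^'m)"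
  by (simp add: norm_vec_def norm_mult L2_set_right_distrib)

lemma square_integrable_smult:
  assumes "square_integrable f"
  shows "square_integrable (\<lambda>x. c *s f x)"
proof -
  have m [measurable]: "f \<in> borel_measurable borel"
    using assms by (auto simp: square_integrable_def)
  have "continuous_on UNIV (\<lambda>v :: 'a spinor. c *s v)"
    unfolding vector_scalar_mult_def by (intro continuous_intros)
  then have "(\<lambda>x. c *s f x) \<in> borel_measurable borel"
    using m by (rule borel_measurable_continuous_on)
  then show ?thesis
    using assms by (auto simp: square_integrable_def periodic_def norm_smult_spinor power_mult_distrib)
qed

lemma integrable_cinner:
  assumes "square_integrable f" "square_integrable g"
  shows "integrable torus_measure (\<lambda>x. spinor_cinner (f x) (g x))"
proof -
  have m: "f \<in> borel_measurable borel" "g \<in> borel_measurable borel"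
    using assms by (auto simp: square_integrable_def)
  have i: "integrable torus_measure (\<lambda>x. (norm (f x))\<^sup>2 + (norm (g x))\<^sup>2)"
    using assms by (auto simp: square_integrable_def)
  have "integrable torus_measure (\<lambda>x. f x $ a * cnj (g x $ a))" for a
  proof (rule Bochner_Integration.integrable_bound[OF i])
    have "continuous_on UNIV (\<lambda>v :: 'a spinor. v $ a)"
      by (intro continuous_intros)
    then have [measurable]: "(\<lambda>x. f x $ a) \<in> borel_measurable borel"
        "(\<lambda>x. g x $ a) \<in> borel_measurable borel"
      using m by (auto intro: borel_measurable_continuous_on)
    have [measurable]: "cnj \<in> borel_measurable borel"
      by (intro borel_measurable_continuous_onI continuous_intros)
    show "(\<lambda>x. f x $ a * cnj (g x $ a)) \<in> borel_measurable torus_measure"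
      by measurable
    have "norm (f x $ a * cnj (g x $ a)) \<le> (norm (f x))\<^sup>2 + (norm (g x))\<^sup>2" for x
    proof -
      have "norm (f x $ a * cnj (g x $ a)) \<le> norm (f x) * norm (g x)"
        by (simp add: norm_mult mult_mono Finite_Cartesian_Product.norm_nth_le)
      also have "\<dots> \<le> (norm (f x))\<^sup>2 + (norm (g x))\<^sup>2"
        using sum_squares_bound[of "norm (f x)" "norm (g x)"] mult_nonneg_nonneg[OF norm_ge_zero norm_ge_zero, of "f x" "g x"]
        unfolding mult.assoc by linarith
      finally show ?thesis .
    qed
    then show "AE x in torus_measure. norm (f x $ a * cnj (g x $ a))
        \<le> norm ((norm (f x))\<^sup>2 + (norm (g x))\<^sup>2)"
      by (simp add: abs_of_nonneg)
  qed
  then show ?thesis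
    by (simp add: spinor_cinner_def)
qed

lemma cinner_self: "spinor_cinner v v = complex_of_real ((norm v)\<^sup>2)"
  by (simp add: spinor_cinner_def norm_vec_def L2_set_def sum_nonneg complex_norm_square flip: of_real_power)


section \<open>The Hilbert space \<open>L\<^sup>2\<close> of spinor fields\<close>

quotient_type (overloaded) 'n L2_spinor = "real^'n \<Rightarrow> 'n spinor" / partial:
  "\<lambda>f g. square_integrable f \<and> square_integrable g \<and> (AE x in torus_measure. f x = g x)"
  morphisms rep_L2 L2_class
proof (rule part_equivpI)
  show "\<exists>f :: real^'n \<Rightarrow> 'n spinor. square_integrable f \<and> square_integrable f \<and> (AE x in torus_measure. f x = f x)"
    using square_integrable_zero by auto
qed (auto intro!: sympI transpI)

instantiation L2_spinor :: (finite) complex_inner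
begin

lift_definition zero_L2_spinor :: "'a L2_spinor" is "\<lambda>_. 0"
  by (simp add: square_integrable_zero)

lift_definition plus_L2_spinor :: "'a L2_spinor \<Rightarrow> 'a L2_spinor \<Rightarrow> 'a L2_spinor"
  is "\<lambda>f g x. f x + g x"
  by (auto intro: square_integrable_add)

lift_definition scaleC_L2_spinor :: "complex \<Rightarrow> 'a L2_spinor \<Rightarrow> 'a L2_spinor"
  is "\<lambda>c f x. c *s f x"
  by (auto intro: square_integrable_smult)

lift_definition cinner_L2_spinor :: "'a L2_spinor \<Rightarrow> 'a L2_spinor \<Rightarrow> complex"
  is "\<lambda>f g. LINT x|torus_measure. spinor_cinner (f x) (g x)"
proof -
  fix f f' g g' :: "real^'a \<Rightarrow> 'a spinor"
  assume a: "square_integrable f \<and> square_integrable f' \<and> (AE x in torus_measure. f x = f' x)"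
    "square_integrable g \<and> square_integrable g' \<and> (AE x in torus_measure. g x = g' x)"
  then show "(LINT x|torus_measure. spinor_cinner (f x) (g x)) =
      (LINT x|torus_measure. spinor_cinner (f' x) (g' x))"
    by (intro integral_cong_AE borel_measurable_integrable integrable_cinner) auto
qed

definition "scaleR_L2_spinor r (x :: 'a L2_spinor) = scaleC (complex_of_real r) x"
definition "uminus_L2_spinor (x :: 'a L2_spinor) = scaleC (- 1) x"
definition "minus_L2_spinor (x :: 'a L2_spinor) y = x + (- y)"
definition "inner_L2_spinor (x :: 'a L2_spinor) y = Re (cinner x y)"
definition "norm_L2_spinor (x :: 'a L2_spinor) = sqrt (inner x x)"
definition "sgn_L2_spinor (x :: 'a L2_spinor) = scaleR (inverse (norm x)) x"
definition "dist_L2_spinor (x :: 'a L2_spinor) y = norm (x - y)"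
definition [code del]: "(uniformity :: ('a L2_spinor \<times> 'a L2_spinor) filter) =
  (INF e\<in>{0<..}. principal {(x, y). dist x y < e})"
definition [code del]: "open_L2_spinor (S :: 'a L2_spinor set) \<longleftrightarrow>
  (\<forall>x\<in>S. \<forall>\<^sub>F (x', y) in uniformity. x' = x \<longrightarrow> y \<in> S)"

instance
proof
  fix x y z :: "'a L2_spinor" and r s :: real and c d :: complex
  show A: "x + y + z = x + (y + z)"
    by transfer (auto intro: square_integrable_add simp: add.assoc)
  show "x + y = y + x"
    by transfer (auto intro: square_integrable_add simp: add.commute)
  show "0 + x = x"
    by transfer auto
  show "- x + x = 0"
    unfolding uminus_L2_spinor_def
    by transfer (auto intro!: square_integrable_add square_integrable_smult square_integrable_zero)
  show "x - y = x + - y"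
    by (simp add: minus_L2_spinor_def)
  show cr: "scaleC c (x + y) = scaleC c x + scaleC c y" for c and x y :: "'a L2_spinor"
    by transfer (auto intro!: square_integrable_add square_integrable_smult simp: vector_add_ldistrib)
  show cl: "scaleC (c + d) x = scaleC c x + scaleC d x" for c d
    by transfer (auto intro!: square_integrable_add square_integrable_smult simp: vector_sadd_rdistrib)
  show cc: "scaleC c (scaleC d x) = scaleC (c * d) x" for c d
    by transfer (auto intro!: square_integrable_smult simp: vector_smult_assoc)
  show c1: "scaleC 1 x = x"
    by transfer auto
  show "scaleC (of_real r) x = r *\<^sub>R x"
    by (simp add: scaleR_L2_spinor_def)
  show "r *\<^sub>R (x + y) = r *\<^sub>R x + r *\<^sub>R y" "(r + s) *\<^sub>R x = r *\<^sub>R x + s *\<^sub>R x"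
    "r *\<^sub>R s *\<^sub>R x = (r * s) *\<^sub>R x" "1 *\<^sub>R x = x"
    by (simp_all add: scaleR_L2_spinor_def cr cl cc c1)
  show cx: "cinner x y = cnj (cinner y x)"
  proof (transfer, clarsimp)
    fix f g :: "real^'a \<Rightarrow> 'a spinor"
    have "spinor_cinner (f x) (g x) = cnj (spinor_cinner (g x) (f x))" for x
      by (simp add: spinor_cinner_def mult.commute)
    then show "(LINT x|torus_measure. spinor_cinner (f x) (g x)) =
        cnj (LINT x|torus_measure. spinor_cinner (g x) (f x))"
      by (simp only: Bochner_Integration.integral_cnj)
  qed
  show ca: "cinner (x + y) z = cinner x z + cinner y z"
  proof (transfer, clarsimp)
    fix f g h :: "real^'a \<Rightarrow> 'a spinor"
    assume *: "square_integrable f" "square_integrable g" "square_integrable h"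
    have "spinor_cinner (f x + g x) (h x) = spinor_cinner (f x) (h x) + spinor_cinner (g x) (h x)" for x
      by (simp add: spinor_cinner_def distrib_right sum.distrib)
    then show "(LINT x|torus_measure. spinor_cinner (f x + g x) (h x)) =
        (LINT x|torus_measure. spinor_cinner (f x) (h x)) + (LINT x|torus_measure. spinor_cinner (g x) (h x))"
      using * by (simp add: integrable_cinner)
  qed
  show cs: "cinner (scaleC c x) y = c * cinner x y" for c
  proof (transfer, clarsimp)
    fix c and f g :: "real^'a \<Rightarrow> 'a spinor"
    have "spinor_cinner (c *s f x) (g x) = c * spinor_cinner (f x) (g x)" for x
      by (simp add: spinor_cinner_def sum_distrib_left mult.assoc)
    then show "(LINT x|torus_measure. spinor_cinner (c *s f x) (g x)) =
        c * (LINT x|torus_measure. spinor_cinner (f x) (g x))"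
      by simp
  qed
  show "inner x y = Re (cinner x y)"
    by (simp add: inner_L2_spinor_def)
  show "inner x y = inner y x"
    unfolding inner_L2_spinor_def by (subst cx) simp
  show "inner (x + y) z = inner x z + inner y z"
    by (simp add: inner_L2_spinor_def ca)
  show "inner (r *\<^sub>R x) y = r * inner x y"
    by (simp add: inner_L2_spinor_def scaleR_L2_spinor_def cs)
  show "0 \<le> inner x x"
    unfolding inner_L2_spinor_def
    by transfer (simp add: cinner_self del: of_real_power)
  show "(inner x x = 0) = (x = 0)"
    unfolding inner_L2_spinor_def
  proof (transfer, clarsimp)
    fix f :: "real^'a \<Rightarrow> 'a spinor"
    assume f: "square_integrable f"
    then have "integrable torus_measure (\<lambda>x. (norm (f x))\<^sup>2)"
      by (simp add: square_integrable_def)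
    then have "(LINT x|torus_measure. (norm (f x))\<^sup>2) = 0 \<longleftrightarrow> (AE x in torus_measure. (norm (f x))\<^sup>2 = 0)"
      by (intro integral_nonneg_eq_0_iff_AE) auto
    then show "(Re (LINT x|torus_measure. spinor_cinner (f x) (f x)) = 0) =
        (square_integrable (\<lambda>_. 0 :: 'a spinor) \<and> (AE x in torus_measure. f x = 0))"
      by (simp add: cinner_self square_integrable_zero del: of_real_power)
  qed
  show "norm x = sqrt (inner x x)"
    by (simp add: norm_L2_spinor_def)
  show "dist x y = norm (x - y)"
    by (simp add: dist_L2_spinor_def)
  show "sgn x = inverse (norm x) *\<^sub>R x"
    by (simp add: sgn_L2_spinor_def)
  show "(uniformity :: ('a L2_spinor \<times> 'a L2_spinor) filter) =
      (INF e\<in>{0<..}. principal {(x, y). dist x y < e})"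
    by (simp add: uniformity_L2_spinor_def)
  show "open U \<longleftrightarrow> (\<forall>x\<in>U. \<forall>\<^sub>F (x', y) in uniformity. x' = x \<longrightarrow> y \<in> U)" for U :: "'a L2_spinor set"
    by (simp add: open_L2_spinor_def)
qed

end


section \<open>The Dirac operator\<close>

definition dirac :: "nat \<Rightarrow> 'n::{finite,linorder} L2_spinor operator" where
  "dirac p = {(L2_class \<psi>, L2_class (dirac_diff p \<psi>)) | \<psi>. \<psi> \<in> smooth_spinors}"

end

theory Submission
  imports Defs
begin

text \<open>On the plane wave \<open>exp (i k x) v\<close> the Dirac operator acts by the matrix \<open>M k\<close>, the Clifford
  multiplication by \<open>i\<close> times the metric dual of \<open>k\<close>, and the Clifford relations give
  \<open>(M k)\<^sup>2 = \<langle>k, k\<rangle>\<close>. Hence \<open>(l - M k) (l + M k) = l\<^sup>2 - \<langle>k, k\<rangle>\<close>: if \<open>l\<^sup>2 = \<langle>k, k\<rangle>\<close> for an integral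
  \<open>k\<close>, then \<open>l\<close> is an eigenvalue of \<open>M k\<close> or of \<open>M (- k) = - M k\<close>, and otherwise every \<open>l - M k\<close>
  is invertible. In the second case the range of \<open>l - D\<close> contains all plane waves, which are dense;
  dually, pairing with plane waves, which turns \<open>D\<close> into the adjoint of \<open>M k\<close> and is stable under
  closure, shows that the closure has no kernel. The resolvent is never bounded, because the
  indefinite form has integral null vectors \<open>k\<close>, for which \<open>M k\<close> is nilpotent and nonzero.\<close>

section \<open>Polynomials are dense in \<open>L\<^sup>2\<close> of a finite measure on a compact set\<close>

text \<open>The Hilbert space inner product is positive definite while the metric is indefinite:
  \<open>M k\<close> is Hermitian along space-like directions and skew-Hermitian along time-like
  ones, so \<open>D\<close> is not symmetric. Hence a separate adjoint symbol is carried along; its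
  square is the same real scalar, because adjoints preserve squares and anticommutation. The graph
  of the closure is never described explicitly. What passes to it are identities continuous in the
  graph, and pairing with one fixed wave is such an identity; since the waves are total, these
  identities determine the kernel. The density of the waves rests on Stone-Weierstrass: the torus
  sits in complex n-space as a product of circles, where real polynomials restrict to trigonometric
  polynomials, and regularity of finite Borel measures leads from continuous to square integrable
  functions. The condition 0 < p < n enters through the null vector, the sum of one time-like and
  one space-like basis vector.\<close>

definition l2_adherent :: "'a measure \<Rightarrow> ('a \<Rightarrow> 'b::real_normed_vector) set \<Rightarrow> ('a \<Rightarrow> 'b) \<Rightarrow> bool" where
  "l2_adherent M F u \<longleftrightarrow>
     (\<forall>e>0. \<exists>g\<in>F. (\<integral>\<^sup>+x. ennreal ((norm (u x - g x))\<^sup>2) \<partial>M) \<le> ennreal e)"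

lemma nn_integral_square_add_le:
  fixes u v :: "'a \<Rightarrow> 'b::{real_normed_vector, second_countable_topology}"
  assumes [measurable]: "u \<in> borel_measurable M" "v \<in> borel_measurable M"
    and "(\<integral>\<^sup>+x. ennreal ((norm (u x))\<^sup>2) \<partial>M) \<le> ennreal (e / 4)"
    and "(\<integral>\<^sup>+x. ennreal ((norm (v x))\<^sup>2) \<partial>M) \<le> ennreal (e / 4)" and "0 < e"
  shows "(\<integral>\<^sup>+x. ennreal ((norm (u x + v x))\<^sup>2) \<partial>M) \<le> ennreal e"
proof -
  have "(norm (u x + v x))\<^sup>2 \<le> 2 * (norm (u x))\<^sup>2 + 2 * (norm (v x))\<^sup>2" for x
  proof -
    have "(norm (u x + v x))\<^sup>2 \<le> (norm (u x) + norm (v x))\<^sup>2"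
      by (simp add: norm_triangle_ineq power_mono)
    also have "\<dots> \<le> 2 * (norm (u x))\<^sup>2 + 2 * (norm (v x))\<^sup>2"
      using sum_squares_bound[of "norm (u x)" "norm (v x)"] by (simp add: power2_sum)
    finally show ?thesis .
  qed
  then have "(\<integral>\<^sup>+x. ennreal ((norm (u x + v x))\<^sup>2) \<partial>M)
      \<le> (\<integral>\<^sup>+x. ennreal (2 * (norm (u x))\<^sup>2 + 2 * (norm (v x))\<^sup>2) \<partial>M)"
    by (intro nn_integral_mono ennreal_leI)
  also have "\<dots> = (\<integral>\<^sup>+x. 2 * ennreal ((norm (u x))\<^sup>2) + 2 * ennreal ((norm (v x))\<^sup>2) \<partial>M)"
    by (intro nn_integral_cong) (simp add: ennreal_plus ennreal_mult)
  also have "\<dots> = 2 * (\<integral>\<^sup>+x. ennreal ((norm (u x))\<^sup>2) \<partial>M) + 2 * (\<integral>\<^sup>+x. ennreal ((norm (v x))\<^sup>2) \<partial>M)"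
    by (simp add: nn_integral_add nn_integral_cmult)
  also have "\<dots> \<le> 2 * ennreal (e / 4) + 2 * ennreal (e / 4)"
    using assms by (intro add_mono mult_left_mono) auto
  also have "\<dots> = ennreal (2 * (e / 4) + 2 * (e / 4))"
    using \<open>0 < e\<close> by (subst ennreal_plus) (auto simp flip: ennreal_numeral ennreal_mult)
  finally show ?thesis by simp
qed

lemma l2_adherent_add:
  fixes u v :: "'a \<Rightarrow> 'b::{real_normed_vector, second_countable_topology}"
  assumes "F \<subseteq> borel_measurable M" "u \<in> borel_measurable M" "v \<in> borel_measurable M"
    and F: "\<And>f g. f \<in> F \<Longrightarrow> g \<in> F \<Longrightarrow> (\<lambda>x. f x + g x) \<in> F"
    and "l2_adherent M F u" "l2_adherent M F v"
  shows "l2_adherent M F (\<lambda>x. u x + v x)"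
  unfolding l2_adherent_def
proof (intro allI impI)
  fix e :: real assume "0 < e"
  then have "0 < e / 4" by simp
  then obtain g h where g: "g \<in> F" "(\<integral>\<^sup>+x. ennreal ((norm (u x - g x))\<^sup>2) \<partial>M) \<le> ennreal (e / 4)"
    and h: "h \<in> F" "(\<integral>\<^sup>+x. ennreal ((norm (v x - h x))\<^sup>2) \<partial>M) \<le> ennreal (e / 4)"
    using assms(5,6) unfolding l2_adherent_def by blast
  have "(\<integral>\<^sup>+x. ennreal ((norm ((u x - g x) + (v x - h x)))\<^sup>2) \<partial>M) \<le> ennreal e"
    using g h \<open>0 < e\<close> assms by (intro nn_integral_square_add_le borel_measurable_diff) auto
  then show "\<exists>k\<in>F. (\<integral>\<^sup>+x. ennreal ((norm (u x + v x - k x))\<^sup>2) \<partial>M) \<le> ennreal e"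
    using F[OF g(1) h(1)] by (intro bexI[of _ "\<lambda>x. g x + h x"]) (simp_all add: algebra_simps)
qed

lemma l2_adherent_limit:
  fixes u :: "'a \<Rightarrow> 'b::{real_normed_vector, second_countable_topology}"
  assumes "F \<subseteq> borel_measurable M" "u \<in> borel_measurable M"
    and lim: "\<And>e. 0 < e \<Longrightarrow> \<exists>v \<in> borel_measurable M. l2_adherent M F v \<and>
       (\<integral>\<^sup>+x. ennreal ((norm (u x - v x))\<^sup>2) \<partial>M) \<le> ennreal e"
  shows "l2_adherent M F u"
  unfolding l2_adherent_def
proof (intro allI impI)
  fix e :: real assume "0 < e"
  then have e4: "0 < e / 4" by simp
  then obtain v where v: "v \<in> borel_measurable M" "l2_adherent M F v"
    "(\<integral>\<^sup>+x. ennreal ((norm (u x - v x))\<^sup>2) \<partial>M) \<le> ennreal (e / 4)"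
    using lim by blast
  then obtain g where g: "g \<in> F" "(\<integral>\<^sup>+x. ennreal ((norm (v x - g x))\<^sup>2) \<partial>M) \<le> ennreal (e / 4)"
    using e4 unfolding l2_adherent_def by blast
  have "(\<integral>\<^sup>+x. ennreal ((norm ((u x - v x) + (v x - g x)))\<^sup>2) \<partial>M) \<le> ennreal e"
    using g v \<open>0 < e\<close> assms by (intro nn_integral_square_add_le borel_measurable_diff) auto
  then show "\<exists>g\<in>F. (\<integral>\<^sup>+x. ennreal ((norm (u x - g x))\<^sup>2) \<partial>M) \<le> ennreal e"
    using g by (intro bexI[of _ g]) simp_all
qed

text \<open>Two families and two value spaces occur because \<open>T\<close> may change the
  codomain: besides scalar multiples this also covers the passage from a scalar function
  \<open>c\<close> to the spinor \<open>c *s v\<close>.\<close>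

lemma l2_adherent_bounded_linear:
  fixes u :: "'a \<Rightarrow> 'b::{real_normed_vector, second_countable_topology}"
  assumes "F \<subseteq> borel_measurable M" "u \<in> borel_measurable M" and T: "bounded_linear T"
    and G: "\<And>f. f \<in> F \<Longrightarrow> (\<lambda>x. T (f x)) \<in> G" and "l2_adherent M F u"
  shows "l2_adherent M G (\<lambda>x. T (u x))"
  unfolding l2_adherent_def
proof (intro allI impI)
  fix e :: real assume "0 < e"
  obtain C where C: "C > 0" "\<And>x. norm (T x) \<le> norm x * C"
    using bounded_linear.pos_bounded[OF T] by blast
  have "0 < e / C\<^sup>2" using C \<open>0 < e\<close> by simp
  then obtain g where g: "g \<in> F" "(\<integral>\<^sup>+x. ennreal ((norm (u x - g x))\<^sup>2) \<partial>M) \<le> ennreal (e / C\<^sup>2)"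
    using assms(5) unfolding l2_adherent_def by blast
  have [measurable]: "g \<in> borel_measurable M" "u \<in> borel_measurable M" using g assms by auto
  have "norm (T (u x) - T (g x)) ^ 2 \<le> C\<^sup>2 * (norm (u x - g x))\<^sup>2" for x
    using power_mono[OF C(2)[of "u x - g x"], of 2]
    by (simp add: bounded_linear.linear[OF T] linear_diff power_mult_distrib mult.commute)
  then have "(\<integral>\<^sup>+x. ennreal ((norm (T (u x) - T (g x)))\<^sup>2) \<partial>M)
      \<le> (\<integral>\<^sup>+x. ennreal (C\<^sup>2) * ennreal ((norm (u x - g x))\<^sup>2) \<partial>M)"
    by (intro nn_integral_mono) (simp flip: ennreal_mult)
  also have "\<dots> \<le> ennreal (C\<^sup>2) * ennreal (e / C\<^sup>2)"
    using g by (subst nn_integral_cmult) (auto intro!: mult_left_mono)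
  also have "\<dots> = ennreal e"
    using C \<open>0 < e\<close> by (simp flip: ennreal_mult)
  finally show "\<exists>g\<in>G. (\<integral>\<^sup>+x. ennreal ((norm (T (u x) - g x))\<^sup>2) \<partial>M) \<le> ennreal e"
    using G[OF g(1)] by (rule bexI)
qed

context
  fixes M :: "'a::euclidean_space measure" and K :: "'a set"
  assumes finite: "finite_measure M" and sets: "sets M = sets borel"
    and K: "compact K" "AE x in M. x \<in> K"
begin

interpretation finite_measure M by (rule finite)

lemma polynomials_measurable: "Collect real_polynomial_function \<subseteq> (borel_measurable M :: ('a \<Rightarrow> real) set)"
proof
  fix f :: "'a \<Rightarrow> real" assume "f \<in> Collect real_polynomial_function"
  then have "continuous_on UNIV f"
    by (simp add: continuous_on_polymonial_function real_polynomial_function_eq)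
  then show "f \<in> borel_measurable M"
    by (simp add: measurable_cong_sets[OF sets refl] borel_measurable_continuous_onI)
qed

text \<open>Stone-Weierstrass gives uniform approximation on \<open>K\<close>, and a uniform bound
  is an L2 bound because the total mass is finite.\<close>

lemma polynomials_l2_continuous:
  assumes "continuous_on UNIV (u :: 'a \<Rightarrow> real)"
  shows "l2_adherent M (Collect real_polynomial_function) u"
  unfolding l2_adherent_def
proof (intro allI impI)
  fix e :: real assume "0 < e"
  \<comment> \<open>The summand 1 keeps the divisor positive when \<open>M\<close> is the zero
    measure.\<close>
  define m where "m = measure M (space M) + 1"
  have m: "m > 0" "measure M (space M) \<le> m" by (simp_all add: m_def add_nonneg_pos)
  obtain g where g: "real_polynomial_function g" "\<And>x. x \<in> K \<Longrightarrow> \<bar>u x - g x\<bar> < sqrt (e / m)"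
    using Stone_Weierstrass_real_polynomial_function[of K u "sqrt (e / m)"] K \<open>0 < e\<close> m assms
    by (metis continuous_on_subset divide_pos_pos real_sqrt_gt_zero subset_UNIV)
  have "(u x - g x)\<^sup>2 \<le> e / m" if "x \<in> K" for x
    using g(2)[OF that] \<open>0 < e\<close> m by (metis less_eq_real_def abs_le_square_iff abs_ge_zero abs_of_nonneg real_sqrt_pow2 divide_nonneg_pos power2_abs power_mono)
  then have "(\<integral>\<^sup>+x. ennreal ((norm (u x - g x))\<^sup>2) \<partial>M) \<le> (\<integral>\<^sup>+x. ennreal (e / m) \<partial>M)"
    using K(2) by (intro nn_integral_mono_AE) (auto intro: ennreal_leI)
  also have "\<dots> = ennreal (e / m * measure M (space M))"
    using \<open>0 < e\<close> m by (simp add: emeasure_eq_measure flip: ennreal_mult)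
  also have "\<dots> \<le> ennreal e"
    using \<open>0 < e\<close> m by (intro ennreal_leI) (simp add: field_simps)
  finally show "\<exists>g\<in>Collect real_polynomial_function. (\<integral>\<^sup>+x. ennreal ((norm (u x - g x))\<^sup>2) \<partial>M) \<le> ennreal e"
    using g by auto
qed

text \<open>Regularity squeezes \<open>A\<close> between a compact \<open>C\<close> and an open
  \<open>U\<close> with small difference. A Urysohn function that is 1 on \<open>C\<close> and 0 off
  \<open>U\<close> differs from the indicator only on \<open>U - C\<close>, by at most 1.\<close>

lemma polynomials_l2_indicator:
  assumes A: "A \<in> sets borel"
  shows "l2_adherent M (Collect real_polynomial_function) (indicator A :: 'a \<Rightarrow> real)"
proof (rule l2_adherent_limit[OF polynomials_measurable])
  show "(indicator A :: 'a \<Rightarrow> real) \<in> borel_measurable M" using A sets by auto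
  fix e :: real assume "0 < e"
  have AM: "A \<in> sets M" using A sets by auto
  have fin: "emeasure M (space M) \<noteq> \<infinity>" by simp
  have in1: "emeasure M A = (SUP K \<in> {K. K \<subseteq> A \<and> compact K}. emeasure M K)"
    by (rule inner_regular[OF sets fin A])
  have out1: "emeasure M A = (INF U \<in> {U. A \<subseteq> U \<and> open U}. emeasure M U)"
    by (rule outer_regular[OF sets fin A])
  have "\<exists>C. C \<subseteq> A \<and> compact C \<and> measure M A < measure M C + e / 2"
  \<comment> \<open>A null set needs its own case: \<open>ennreal\<close> truncates negative numbers
    to 0, so no number lies strictly below \<open>emeasure M A\<close>.\<close>
  proof (cases "measure M A = 0")
    case True
    then show ?thesis using \<open>0 < e\<close> by (intro exI[of _ "{}"]) simp
  next
    case False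
    then have "0 < measure M A" using measure_nonneg[of M A] by linarith
    then have "ennreal (measure M A - e / 2) < emeasure M A"
      using \<open>0 < e\<close> by (simp add: emeasure_eq_measure ennreal_lessI)
    then obtain C where "C \<subseteq> A" "compact C" "ennreal (measure M A - e / 2) < emeasure M C"
      by (subst (asm) in1) (auto simp: less_SUP_iff)
    moreover from this(3) have "measure M A - e / 2 < measure M C"
      by (metis emeasure_eq_measure ennreal_leI linorder_not_less)
    ultimately show ?thesis by (intro exI[of _ C]) simp
  qed
  then obtain C where C: "C \<subseteq> A" "compact C" "measure M A < measure M C + e / 2" by blast
  have "emeasure M A < ennreal (measure M A + e / 2)"
    using \<open>0 < e\<close> by (simp add: emeasure_eq_measure ennreal_less_iff)
  then obtain U where U: "A \<subseteq> U" "open U" "emeasure M U < ennreal (measure M A + e / 2)"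
    by (subst (asm) out1) (auto simp: INF_less_iff)
  have U3: "measure M U < measure M A + e / 2"
    using U(3) by (simp add: emeasure_eq_measure ennreal_less_iff)
  have CU: "C \<in> sets M" "U \<in> sets M" using C U sets by (auto simp: compact_imp_closed)
  obtain f :: "'a \<Rightarrow> real" where f: "continuous_on UNIV f" "\<And>x. f x \<in> closed_segment 0 1"
    "\<And>x. x \<in> - U \<Longrightarrow> f x = 0" "\<And>x. x \<in> C \<Longrightarrow> f x = 1"
    using Urysohn[of "- U" C 0 1] C U by (auto simp: compact_imp_closed)
  have "(\<integral>\<^sup>+x. ennreal ((norm (indicator A x - f x))\<^sup>2) \<partial>M) \<le> (\<integral>\<^sup>+x. indicator (U - C) x \<partial>M)"
  proof (rule nn_integral_mono)
    fix x
    have "0 \<le> f x" "f x \<le> 1" using f(2)[of x] by (auto simp: closed_segment_eq_real_ivl)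
    then have "\<bar>indicator A x - f x\<bar> \<le> 1" by (auto simp: indicator_def)
    then show "ennreal ((norm (indicator A x - f x))\<^sup>2) \<le> indicator (U - C) x"
      using f(3)[of x] f(4)[of x] C(1) U(1)
      by (auto simp: indicator_def abs_square_le_1 split: if_splits)
  qed
  also have "\<dots> = ennreal (measure M (U - C))"
    using CU by (simp add: emeasure_eq_measure)
  also have "\<dots> \<le> ennreal e"
    using CU C U U3 by (intro ennreal_leI) (simp add: finite_measure_Diff)
  finally show "\<exists>v\<in>borel_measurable M. l2_adherent M (Collect real_polynomial_function) v \<and>
      (\<integral>\<^sup>+x. ennreal ((norm (indicator A x - v x))\<^sup>2) \<partial>M) \<le> ennreal e"
    using f(1) by (intro bexI[of _ f])
      (auto intro: polynomials_l2_continuous simp: measurable_cong_sets[OF sets refl] borel_measurable_continuous_onI)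
qed

text \<open>Finiteness of the L2 norm has to descend to the pieces of the induction. Nonnegativity
  provides this: both summands of a sum, and all members of an increasing sequence, are dominated
  pointwise by the whole.\<close>

lemma polynomials_l2_nonneg:
  fixes u :: "'a \<Rightarrow> real"
  assumes "u \<in> borel_measurable borel" "\<And>x. 0 \<le> u x" "(\<integral>\<^sup>+x. ennreal ((u x)\<^sup>2) \<partial>M) < \<infinity>"
  shows "l2_adherent M (Collect real_polynomial_function) u"
proof -
  \<comment> \<open>Finiteness becomes part of the induction predicate, since it has to be
    re-established for every piece.\<close>
  have "(\<integral>\<^sup>+x. ennreal ((u x)\<^sup>2) \<partial>M) < \<infinity> \<longrightarrow> l2_adherent M (Collect real_polynomial_function) u"
    using assms(1,2)
  proof (induction u rule: borel_measurable_induct_real)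
    case (set A)
    then show ?case by (simp add: polynomials_l2_indicator)
  next
    case (mult u c)
    show ?case
    \<comment> \<open>For \<open>c = 0\<close> the finite integral carries no information about
      \<open>u\<close>, but the product is the constant 0.\<close>
    proof (intro impI, cases "c = 0")
      assume "c = 0"
      then show "l2_adherent M (Collect real_polynomial_function) (\<lambda>x. c * u x)"
        using polynomials_l2_continuous[of "\<lambda>_. 0"] by simp
    next
      assume prems: "(\<integral>\<^sup>+x. ennreal ((c * u x)\<^sup>2) \<partial>M) < \<infinity>" and "c \<noteq> 0"
      have [measurable]: "u \<in> borel_measurable M" using mult by (simp add: measurable_cong_sets[OF sets refl])
      have "(\<integral>\<^sup>+x. ennreal ((c * u x)\<^sup>2) \<partial>M) = ennreal (c\<^sup>2) * (\<integral>\<^sup>+x. ennreal ((u x)\<^sup>2) \<partial>M)"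
        by (simp add: power_mult_distrib ennreal_mult nn_integral_cmult)
      with prems \<open>c \<noteq> 0\<close> have "(\<integral>\<^sup>+x. ennreal ((u x)\<^sup>2) \<partial>M) < \<infinity>"
        by (auto simp: ennreal_mult_less_top ennreal_mult_eq_top_iff less_top)
      then have "l2_adherent M (Collect real_polynomial_function) u" using mult.IH by simp
      then show "l2_adherent M (Collect real_polynomial_function) (\<lambda>x. c * u x)"
        by (intro l2_adherent_bounded_linear[OF polynomials_measurable _ bounded_linear_mult_right])
        (auto intro: real_polynomial_function.intros(4)[OF real_polynomial_function.intros(2)])
    qed
  next
    case (add u v)
    show ?case
    proof
      assume prems: "(\<integral>\<^sup>+x. ennreal ((v x + u x)\<^sup>2) \<partial>M) < \<infinity>"
      have le: "(u x)\<^sup>2 \<le> (v x + u x)\<^sup>2" "(v x)\<^sup>2 \<le> (v x + u x)\<^sup>2" for x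
        using add.hyps(2)[of x] add.hyps(4)[of x] by (simp_all add: power_mono)
      have "(\<integral>\<^sup>+x. ennreal ((u x)\<^sup>2) \<partial>M) < \<infinity>" "(\<integral>\<^sup>+x. ennreal ((v x)\<^sup>2) \<partial>M) < \<infinity>"
        by (rule le_less_trans[OF nn_integral_mono prems], rule ennreal_leI, rule le)+
      then have "l2_adherent M (Collect real_polynomial_function) u" "l2_adherent M (Collect real_polynomial_function) v"
        using add.IH by auto
      then show "l2_adherent M (Collect real_polynomial_function) (\<lambda>x. v x + u x)"
        using add.hyps(1,3) by (intro l2_adherent_add[OF polynomials_measurable])
        (simp_all add: measurable_cong_sets[OF sets refl] real_polynomial_function.intros(3))
    qed
  next
    case (seq U)
    show ?case
    proof
      assume prems: "(\<integral>\<^sup>+x. ennreal ((u x)\<^sup>2) \<partial>M) < \<infinity>"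
      have [measurable]: "u \<in> borel_measurable M" "\<And>i. U i \<in> borel_measurable M"
        using seq.hyps(1) assms(1) by (simp_all add: measurable_cong_sets[OF sets refl])
      have le: "U i x \<le> u x" for i x
        using seq.hyps(3) seq.hyps(4)[of x] by (intro incseq_le) (auto simp: incseq_def le_fun_def)
      have le2: "(U i x)\<^sup>2 \<le> (u x)\<^sup>2" "(u x - U i x)\<^sup>2 \<le> (u x)\<^sup>2" for i x
        using seq.hyps(2)[of i x] le[where i=i and x=x] by (simp_all add: power_mono)
      have lim: "(\<lambda>i. \<integral>\<^sup>+x. ennreal ((norm (u x - U i x))\<^sup>2) \<partial>M) \<longlonglongrightarrow> (\<integral>\<^sup>+x. 0 \<partial>M)"
      proof (rule nn_integral_dominated_convergence[where w="\<lambda>x. ennreal ((u x)\<^sup>2)"])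
        show "AE x in M. (\<lambda>i. ennreal ((norm (u x - U i x))\<^sup>2)) \<longlonglongrightarrow> 0"
        proof (rule AE_I2)
          fix x
          have "(\<lambda>i. (norm (u x - U i x))\<^sup>2) \<longlonglongrightarrow> (norm (u x - u x))\<^sup>2"
            using seq.hyps(4)[of x] by (intro tendsto_intros) auto
          then show "(\<lambda>i. ennreal ((norm (u x - U i x))\<^sup>2)) \<longlonglongrightarrow> 0"
            using tendsto_ennrealI by fastforce
        qed
      qed (use le2 prems in \<open>auto intro!: ennreal_leI\<close>)
      have adh: "l2_adherent M (Collect real_polynomial_function) (U i)" for i
        by (rule seq.IH[rule_format], rule le_less_trans[OF nn_integral_mono prems], rule ennreal_leI, rule le2)
      show "l2_adherent M (Collect real_polynomial_function) u"
      proof (rule l2_adherent_limit[OF polynomials_measurable])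
        fix e :: real assume "0 < e"
        then have "\<forall>\<^sub>F i in sequentially. (\<integral>\<^sup>+x. ennreal ((norm (u x - U i x))\<^sup>2) \<partial>M) < ennreal e"
          using lim by (intro order_tendstoD(2)[OF lim]) simp
        then obtain i where "(\<integral>\<^sup>+x. ennreal ((norm (u x - U i x))\<^sup>2) \<partial>M) < ennreal e"
          by (auto simp: eventually_sequentially)
        then show "\<exists>v\<in>borel_measurable M. l2_adherent M (Collect real_polynomial_function) v \<and>
          (\<integral>\<^sup>+x. ennreal ((norm (u x - v x))\<^sup>2) \<partial>M) \<le> ennreal e"
          using adh by (intro bexI[of _ "U i"]) auto
      qed simp
    qed
  qed
  with assms(3) show ?thesis by simp
qed

lemma polynomials_l2_dense:
  fixes u :: "'a \<Rightarrow> real"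
  assumes u: "u \<in> borel_measurable borel" "(\<integral>\<^sup>+x. ennreal ((u x)\<^sup>2) \<partial>M) < \<infinity>"
  shows "l2_adherent M (Collect real_polynomial_function) u"
proof -
  have le: "(max 0 (u x))\<^sup>2 \<le> (u x)\<^sup>2" "(max 0 (- u x))\<^sup>2 \<le> (u x)\<^sup>2" for x
    by (auto simp: max_def)
  have "(\<integral>\<^sup>+x. ennreal ((max 0 (u x))\<^sup>2) \<partial>M) < \<infinity>" "(\<integral>\<^sup>+x. ennreal ((max 0 (- u x))\<^sup>2) \<partial>M) < \<infinity>"
    by (rule le_less_trans[OF nn_integral_mono u(2)], rule ennreal_leI, rule le)+
  then have *: "l2_adherent M (Collect real_polynomial_function) (\<lambda>x. max 0 (u x))"
    "l2_adherent M (Collect real_polynomial_function) (\<lambda>x. max 0 (- u x))"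
    using u by (auto intro!: polynomials_l2_nonneg)
  have [measurable]: "u \<in> borel_measurable M" using u by (simp add: measurable_cong_sets[OF sets refl])
  have "l2_adherent M (Collect real_polynomial_function) (\<lambda>x. - 1 * max 0 (- u x))"
    using *(2) by (intro l2_adherent_bounded_linear[OF polynomials_measurable _ bounded_linear_mult_right])
      (auto intro: real_polynomial_function.intros(4)[OF real_polynomial_function.intros(2)] simp del: mult_minus1)
  with *(1) have "l2_adherent M (Collect real_polynomial_function) (\<lambda>x. max 0 (u x) + - 1 * max 0 (- u x))"
    by (intro l2_adherent_add[OF polynomials_measurable]) (auto intro: real_polynomial_function.intros(3))
  moreover have "(\<lambda>x. max 0 (u x) + - 1 * max 0 (- u x)) = u" by (auto simp: max_def)
  ultimately show ?thesis by simp
qed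

end

section \<open>Clifford relations of the Kronecker matrices\<close>

definition mat2_mult :: "nmat \<Rightarrow> nmat \<Rightarrow> nmat" where
  "mat2_mult A B = (\<lambda>i j. A i 0 * B 0 j + A i 1 * B 1 j)"

lemma sum_lessThan_add:
  "(\<Sum>b<m + n. f b) = (\<Sum>b<m. f b) + (\<Sum>b<n. f (m + b :: nat))" for f :: "nat \<Rightarrow> 'a::comm_monoid_add"
  by (induction n) (simp_all add: ac_simps)

text \<open>This is the mixed-product rule for Kronecker products. The summation range is cut at
  \<open>N\<close>: on each half \<open>b div N\<close> is constant, 0 or 1, while
  \<open>b mod N\<close> runs through all indices of the remaining factors.\<close>

lemma kronecker_mult:
  assumes "length As = length Bs"
  shows "(\<Sum>b<2 ^ length As. kronecker As a b * kronecker Bs b c) = kronecker (map2 mat2_mult As Bs) a c"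
  using assms
proof (induction As Bs arbitrary: a c rule: list_induct2)
  case Nil
  then show ?case by simp
next
  case (Cons A As B Bs)
  define N :: nat where "N = 2 ^ length As"
  have N: "N > 0" "2 ^ length Bs = N" using Cons by (simp_all add: N_def)
  have "(\<Sum>b<2 ^ length (A # As). kronecker (A # As) a b * kronecker (B # Bs) b c)
      = (\<Sum>b<N + N. (A (a div N) (b div N) * kronecker As (a mod N) (b mod N)) *
           (B (b div N) (c div N) * kronecker Bs (b mod N) (c mod N)))"
    using N by (simp add: N_def mult_2)
  also have "\<dots> = (A (a div N) 0 * B 0 (c div N) + A (a div N) 1 * B 1 (c div N)) *
      (\<Sum>b<N. kronecker As (a mod N) b * kronecker Bs b (c mod N))"
    unfolding sum_lessThan_add using N
    by (simp add: algebra_simps sum_distrib_left)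
  also have "(\<Sum>b<N. kronecker As (a mod N) b * kronecker Bs b (c mod N)) =
      kronecker (map2 mat2_mult As Bs) (a mod N) (c mod N)"
    unfolding N_def by (rule Cons.IH)
  finally show ?case
    using Cons.hyps by (simp add: mat2_mult_def N_def)
qed

text \<open>Multilinearity of the tensor product. With signs for \<open>s r\<close> it reduces the
  Clifford relations to the single tensor factors.\<close>

lemma kronecker_scaled:
  assumes "length As = length Bs" "\<And>r i j. r < length As \<Longrightarrow> (As ! r) i j = s r * (Bs ! r) i j"
  shows "kronecker As a b = (\<Prod>r<length As. s r) * kronecker Bs a b"
  using assms
proof (induction As Bs arbitrary: s a b rule: list_induct2)
  case Nil
  then show ?case by simp
next
  case (Cons A As B Bs)
  have "kronecker As a b = (\<Prod>r<length As. s (Suc r)) * kronecker Bs a b" for a b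
    using Cons.prems[of "Suc _"] by (intro Cons.IH) auto
  moreover have "A i j = s 0 * B i j" for i j
    using Cons.prems[of 0] by simp
  ultimately show ?case
    using Cons.hyps by (simp add: prod.lessThan_Suc_shift del: prod.lessThan_Suc)
qed

text \<open>An index is determined by its quotient and remainder. The bounds on \<open>a\<close> and
  \<open>b\<close> enter because \<open>mat2\<close> reads every nonzero index as 1.\<close>

lemma kronecker_one:
  "a < 2 ^ m \<Longrightarrow> b < 2 ^ m \<Longrightarrow> kronecker (replicate m E_mat) a b = (if a = b then 1 else 0)"
proof (induction m arbitrary: a b)
  case 0
  then show ?case by simp
next
  case (Suc m)
  define N :: nat where "N = 2 ^ m"
  have ab: "a div N < 2" "b div N < 2" "N > 0"
    using Suc.prems by (auto simp: N_def less_mult_imp_div_less)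
  have "kronecker (replicate m E_mat) (a mod N) (b mod N) = (if a mod N = b mod N then 1 else 0)"
    by (rule Suc.IH) (simp_all add: N_def)
  moreover have "a = b \<longleftrightarrow> a div N = b div N \<and> a mod N = b mod N"
    by (metis div_mult_mod_eq)
  moreover have "E_mat (a div N) (b div N) = (if a div N = b div N then 1 else 0)"
    using ab by (auto simp: E_mat_def less_2_cases_iff)
  ultimately show ?case
    by (auto simp: N_def)
qed

text \<open>Counting the tensor factors of \<open>kappa\<close> from the right gives one description for all
  indices \<open>j\<close> up to \<open>2 * m + 1\<close>.\<close>

definition slot :: "nat \<Rightarrow> nat \<Rightarrow> nmat" where
  "slot j t = (if t < (j - 1) div 2 then T_mat else if t = (j - 1) div 2
     then (if odd j then U1_mat else U2_mat) else E_mat)"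

text \<open>List positions count factors from the left, \<open>slot\<close> counts from the right;
  \<open>m - 1 - r\<close> converts one into the other.\<close>

definition slots :: "nat \<Rightarrow> nat \<Rightarrow> nmat list" where
  "slots m j = map (\<lambda>r. slot j (m - 1 - r)) [0..<m]"

text \<open>The last index of an odd dimension fits the pattern: for \<open>j = 2 * m + 1\<close>
  the position of the factor \<open>U\<close> would be \<open>m\<close>, beyond all slots, so only
  factors \<open>T\<close> remain.\<close>

lemma kappa_slots:
  assumes "1 \<le> j" "j \<le> 2 * m + 1"
  shows "kappa m p j a b = tau p j * (if j \<le> 2 * m then 1 else \<i>) * kronecker (slots m j) a b"
proof (cases "j \<le> 2 * m")
  case True
  define d where "d = (j - Suc 0) div 2"
  have "d < m" using True assms by (simp add: d_def)
  then have "replicate (m - 1 - d) E_mat @ [if odd j then U1_mat else U2_mat] @ replicate d T_mat = slots m j"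
    by (intro nth_equalityI; simp add: slots_def slot_def nth_append nth_Cons' flip: d_def; linarith)
  then show ?thesis using True by (simp add: kappa_def d_def)
next
  case False
  then have "j = 2 * m + 1" using assms by simp
  then have "replicate m T_mat = slots m j"
    by (intro nth_equalityI) (auto simp: slots_def slot_def)
  then show ?thesis using False by (simp add: kappa_def)
qed

lemmas slot_mats = slot_def mat2_mult_def E_mat_def U1_mat_def U2_mat_def T_mat_def fun_eq_iff

text \<open>Up to factors \<i> these are the Pauli matrices: \<open>T\<close> and \<open>E\<close>
  square to the identity, both \<open>U\<close> to its negative, and \<open>U\<close> occupies one
  position only.\<close>

lemma slot_mult_self:
  "mat2_mult (slot j t) (slot j t) i k = (if t = (j - 1) div 2 then - 1 else 1) * E_mat i k"
  by (auto simp: slot_mats)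

text \<open>Only the position of the \<open>U\<close> of the smaller index \<open>i\<close> produces
  a sign: there \<open>j\<close> has \<open>T\<close>, or the other \<open>U\<close> if the
  positions coincide. To its right both factors are \<open>T\<close>, to its left that of
  \<open>i\<close> is \<open>E\<close>.\<close>

lemma slot_anticommute:
  assumes "1 \<le> i" "i < j"
  shows "mat2_mult (slot i t) (slot j t) a b =
    (if t = (i - 1) div 2 then - 1 else 1) * mat2_mult (slot j t) (slot i t) a b"
proof -
  have "(i - 1) div 2 < (j - 1) div 2 \<or> (i - 1) div 2 = (j - 1) div 2 \<and> odd i \<and> even j"
    using assms by (auto elim!: oddE evenE) presburger+
  then show ?thesis
    by (auto simp: slot_mats)
qed

lemma prod_sign_slots:
  fixes m d :: nat
  shows "(\<Prod>r<m. if m - 1 - r = d then - 1 else 1 :: complex) = (if d < m then - 1 else 1)"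
proof -
  \<comment> \<open>For \<open>d \<ge> m\<close> truncated subtraction makes
    \<open>m - 1 - d\<close> equal to 0, possibly a genuine index; the inner conditional assigns it
    the value 1.\<close>
  have "(\<Prod>r<m. if m - 1 - r = d then - 1 else 1 :: complex) = (\<Prod>r<m. if r = m - 1 - d then if d < m then - 1 else 1 else 1)"
    by (rule prod.cong) auto
  also have "\<dots> = (if d < m then - 1 else 1)"
    by (subst prod.delta) auto
  finally show ?thesis .
qed

lemma slots_mult:
  "(\<Sum>b<2 ^ m. kronecker (slots m i) a b * kronecker (slots m j) b c) =
    kronecker (map (\<lambda>r. mat2_mult (slot i (m - 1 - r)) (slot j (m - 1 - r))) [0..<m]) a c"
proof -
  have "map2 mat2_mult (slots m i) (slots m j) =
      map (\<lambda>r. mat2_mult (slot i (m - 1 - r)) (slot j (m - 1 - r))) [0..<m]"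
    by (intro nth_equalityI) (auto simp: slots_def)
  then show ?thesis
    using kronecker_mult[of "slots m i" "slots m j" a c] by (simp add: slots_def)
qed

text \<open>For \<open>j = 2 * m + 1\<close> there is no factor \<open>U\<close>, hence no sign; the
  extra \<i> in \<open>kappa\<close> later supplies the missing -1.\<close>

lemma slots_mult_self:
  assumes "1 \<le> j" "j \<le> 2 * m + 1" "a < 2 ^ m" "c < 2 ^ m"
  shows "(\<Sum>b<2 ^ m. kronecker (slots m j) a b * kronecker (slots m j) b c) =
    (if j \<le> 2 * m then - 1 else 1) * (if a = c then 1 else 0)"
proof -
  have "(\<Sum>b<2 ^ m. kronecker (slots m j) a b * kronecker (slots m j) b c) =
      (\<Prod>r<m. if m - 1 - r = (j - 1) div 2 then - 1 else 1) * kronecker (replicate m E_mat) a c"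
    unfolding slots_mult by (subst kronecker_scaled[where Bs = "replicate m E_mat" and
          s = "\<lambda>r. if m - 1 - r = (j - 1) div 2 then - 1 else 1"]) (auto simp: slot_mult_self)
  moreover have "(j - 1) div 2 < m \<longleftrightarrow> j \<le> 2 * m"
    using assms by linarith
  ultimately show ?thesis
    using assms by (simp only: prod_sign_slots kronecker_one)
qed

lemma slots_anticommute:
  assumes "1 \<le> i" "i < j" "j \<le> 2 * m + 1"
  shows "(\<Sum>b<2 ^ m. kronecker (slots m i) a b * kronecker (slots m j) b c) =
    - (\<Sum>b<2 ^ m. kronecker (slots m j) a b * kronecker (slots m i) b c)"
proof -
  have "(\<Sum>b<2 ^ m. kronecker (slots m i) a b * kronecker (slots m j) b c) =
      (\<Prod>r<m. if m - 1 - r = (i - 1) div 2 then - 1 else 1) *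
      (\<Sum>b<2 ^ m. kronecker (slots m j) a b * kronecker (slots m i) b c)"
    unfolding slots_mult by (subst kronecker_scaled[where
          s = "\<lambda>r. if m - 1 - r = (i - 1) div 2 then - 1 else 1"])
      (auto simp: slot_anticommute[OF assms(1,2)])
  \<comment> \<open>Being smaller than \<open>j\<close>, the index \<open>i\<close> is at most
    \<open>2 * m\<close>, so its sign position really occurs among the \<open>m\<close>
    factors.\<close>
  moreover have "(i - 1) div 2 < m"
    using assms by linarith
  ultimately show ?thesis
    by (simp only: prod_sign_slots) simp
qed

section \<open>Clifford relations for the matrices indexed by coordinates\<close>

lemma pos_ge_1: "1 \<le> pos (i :: 'n::{finite,linorder})"
  using card_gt_0_iff[of "{k. k \<le> i}"] by (auto simp: pos_def Suc_le_eq)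

lemma pos_le_card: "pos (i :: 'n::{finite,linorder}) \<le> CARD('n)"
  by (simp add: pos_def card_mono)

lemma pos_less: "i < j \<Longrightarrow> pos i < pos (j :: 'n::{finite,linorder})"
  unfolding pos_def
proof (intro psubset_card_mono psubsetI)
  assume "i < j"
  then have "j \<in> {k. k \<le> j}" "j \<notin> {k. k \<le> i}" by auto
  then show "{k. k \<le> i} \<noteq> {k. k \<le> j}" by blast
qed auto

text \<open>Carries the sum over the type \<open>spin_index\<close> over to natural numbers, where
  the Kronecker calculus applies. The scalar \<open>c\<close> collects \<open>tau\<close> and the
  factor \<i> of the last odd index.\<close>

lemma gamma_mat_mult_nth:
  fixes i j :: "'n::{finite,linorder}" and p :: nat
  defines "m \<equiv> CARD('n) div 2" and "c \<equiv> \<lambda>k::nat. tau p k * (if k \<le> 2 * (CARD('n) div 2) then 1 else \<i>)"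
  shows "(gamma_mat p i ** gamma_mat p j) $ a $ b = c (pos i) * c (pos j) *
    (\<Sum>k<2 ^ m. kronecker (slots m (pos i)) (Rep_spin_index a) k * kronecker (slots m (pos j)) k (Rep_spin_index b))"
proof -
  have n: "pos (i :: 'n) \<le> 2 * m + 1" for i
    using pos_le_card[of i] by (auto simp: m_def)
  have "bij_betw Rep_spin_index (UNIV :: 'n spin_index set) {..<2 ^ m}"
    unfolding bij_betw_def m_def using type_definition.Rep_range[OF type_definition_spin_index]
    by (auto simp: inj_on_def Rep_spin_index_inject)
  then have "(\<Sum>k<2 ^ m. kappa m p (pos i) (Rep_spin_index a) k * kappa m p (pos j) k (Rep_spin_index b)) =
      (\<Sum>k\<in>UNIV. kappa m p (pos i) (Rep_spin_index a) (Rep_spin_index (k :: 'n spin_index)) *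
        kappa m p (pos j) (Rep_spin_index k) (Rep_spin_index b))"
    by (rule sum.reindex_bij_betw[symmetric])
  then show ?thesis
    by (simp add: matrix_matrix_mult_def gamma_mat_def kappa_slots[OF pos_ge_1 n] c_def sum_distrib_left mult_ac flip: m_def)
qed

lemma tau_square: "tau p j * tau p j = (if j \<le> p then - 1 else 1)"
  by (simp add: tau_def)

text \<open>The slots give -1, or the factor \<i> squared does for the last odd index; multiplied by
  the square of \<open>tau\<close> this is the negative of the metric sign.\<close>

lemma gamma_mat_square:
  fixes i :: "'n::{finite,linorder}"
  shows "gamma_mat p i ** gamma_mat p i = mat (if pos i \<le> p then 1 else - 1)"
proof -
  have "(gamma_mat p i ** gamma_mat p i) $ a $ b = mat (if pos i \<le> p then 1 else - 1) $ a $ b" for a b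
  proof -
    have "pos i \<le> 2 * (CARD('n) div 2) + 1" using pos_le_card[of i] by auto
    then show ?thesis
      using Rep_spin_index[of a] Rep_spin_index[of b] tau_square[of p "pos i"]
      unfolding gamma_mat_mult_nth
      by (subst slots_mult_self[OF pos_ge_1]) (auto simp: mat_def Rep_spin_index_inject mult_ac)
  qed
  then show ?thesis by (simp add: vec_eq_iff)
qed

lemma gamma_mat_anticommute:
  fixes i j :: "'n::{finite,linorder}"
  assumes "i \<noteq> j"
  shows "gamma_mat p i ** gamma_mat p j = - (gamma_mat p j ** gamma_mat p i)"
proof -
  have *: "gamma_mat p i ** gamma_mat p j = - (gamma_mat p j ** gamma_mat p i)" if "i < j" for i j :: 'n
  proof -
    have n: "pos j \<le> 2 * (CARD('n) div 2) + 1" using pos_le_card[of j] by auto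
    show ?thesis
      unfolding vec_eq_iff uminus_vec_def vec_lambda_beta vector_uminus_component gamma_mat_mult_nth
      using slots_anticommute[OF pos_ge_1 pos_less[OF that] n] by (simp add: mult_ac)
  qed
  from assms consider "i < j" | "j < i" by fastforce
  then show ?thesis
  proof cases
    case 2
    then show ?thesis using *[of j i] by simp
  qed (rule *)
qed

section \<open>Integration over the torus\<close>

text \<open>Half open, so that its translates by periods tile the space without overlap. The closed
  box of \<open>torus_measure\<close> differs from it by a null set.\<close>

definition cell :: "(real^'n) set" where
  "cell = {x. \<forall>i. 0 \<le> x $ i \<and> x $ i < 2 * pi}"

lemma cell_measurable [measurable]: "(cell :: (real^'n) set) \<in> sets borel"
proof -
  have "(cell :: (real^'n) set) = (\<Inter>i\<in>UNIV. {x. 0 \<le> x $ i} \<inter> {x. x $ i < 2 * pi})"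
    by (auto simp: cell_def)
  also have "\<dots> \<in> sets borel"
    by (intro sets.finite_INT sets.Int borel_closed borel_open closed_Collect_le open_Collect_less continuous_intros) auto
  finally show ?thesis .
qed

lemma AE_cell:
  "AE x in lborel. x \<in> (cell :: (real^'n) set) \<longleftrightarrow> x \<in> cbox 0 (\<chi> i. 2 * pi)"
proof -
  have "negligible (cbox 0 (\<chi> i. 2 * pi) - box 0 (\<chi> i. 2 * pi) :: (real^'n) set)"
    by (rule negligible_frontier_interval)
  then have "(cbox 0 (\<chi> i. 2 * pi) - box 0 (\<chi> i. 2 * pi) :: (real^'n) set) \<in> null_sets lborel"
    by (simp add: negligible_iff_null_sets null_sets_completion_iff)
  then have "AE x in lborel. x \<notin> (cbox 0 (\<chi> i. 2 * pi) - box 0 (\<chi> i. 2 * pi) :: (real^'n) set)"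
    by (rule AE_not_in)
  then show ?thesis
  proof eventually_elim
    case (elim x)
    have "x \<in> box 0 (\<chi> i. 2 * pi) \<Longrightarrow> x \<in> cell" "x \<in> cell \<Longrightarrow> x \<in> cbox 0 (\<chi> i. 2 * pi)"
      by (auto simp: cell_def mem_box_cart less_imp_le)
    with elim show ?case using box_subset_cbox by blast
  qed
qed

definition cell_volume :: "'n::finite itself \<Rightarrow> real" where
  "cell_volume _ = measure lborel (cbox 0 (\<chi> i. 2 * pi) :: (real^'n) set)"

lemma emeasure_period_box:
  "emeasure lborel (cbox 0 (\<chi> i. 2 * pi) :: (real^'n) set) = ennreal (cell_volume TYPE('n))"
  unfolding cell_volume_def by (rule emeasure_eq_ennreal_measure) (simp add: emeasure_lborel_cbox_eq)

lemma cell_volume_pos: "0 < cell_volume TYPE('n::finite)"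
proof -
  have "(\<chi> i. 2 * pi) \<bullet> b > 0" if "b \<in> Basis" for b :: "real^'n"
    using that by (auto simp: Basis_vec_def inner_axis)
  then show ?thesis
    unfolding cell_volume_def by (simp add: measure_lborel_cbox_eq prod_pos less_imp_le)
qed

lemma torus_measure_eq_density:
  "(torus_measure :: (real^'n) measure) = density lborel (\<lambda>x. ennreal (indicator cell x / cell_volume TYPE('n)))"
proof -
  have "(torus_measure :: (real^'n) measure) =
      density lborel (\<lambda>x. ennreal (indicator (cbox 0 (\<chi> i. 2 * pi)) x / cell_volume TYPE('n)))"
    unfolding torus_measure_def uniform_measure_def emeasure_period_box
    using cell_volume_pos[where 'n='n]
    by (intro arg_cong2[of _ _ _ _ density] refl ext) (simp add: ennreal_indicator[symmetric] divide_ennreal)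
  also have "\<dots> = density lborel (\<lambda>x. ennreal (indicator cell x / cell_volume TYPE('n)))"
    by (rule density_cong) (use AE_cell in \<open>auto simp: indicator_def elim!: eventually_mono\<close>)
  finally show ?thesis .
qed

lemma emeasure_torus_measure_UNIV: "emeasure (torus_measure :: (real^'n) measure) UNIV = 1"
  using cell_volume_pos[where 'n='n]
  by (simp add: torus_measure_def emeasure_uniform_measure emeasure_period_box divide_ennreal)

lemma finite_measure_torus: "finite_measure (torus_measure :: (real^'n) measure)"
  by (rule finite_measureI) (simp add: emeasure_torus_measure_UNIV)

lemma integral_torus_measure_const: "(LINT x|(torus_measure :: (real^'n) measure). c) = (c :: 'b::{banach, second_countable_topology})"
  by (simp add: measure_def emeasure_torus_measure_UNIV)

lemma integral_torus_measure:
  fixes f :: "real^'n \<Rightarrow> 'b::{banach, second_countable_topology}"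
  assumes "f \<in> borel_measurable borel"
  shows "(LINT x|torus_measure. f x) = (LINT x|lborel. indicator cell x *\<^sub>R f x) /\<^sub>R cell_volume TYPE('n)"
  unfolding torus_measure_eq_density using assms cell_volume_pos[where 'n='n]
  by (subst integral_density) (auto simp: divide_inverse mult.commute simp flip: scaleR_scaleR)

lemma AE_torus_measure_cell: "AE x in (torus_measure :: (real^'n) measure). x \<in> cell"
  unfolding torus_measure_eq_density by (subst AE_density) (auto simp: indicator_def)

lemma lborel_integral_translate:
  fixes f :: "'a::euclidean_space \<Rightarrow> 'b::{banach, second_countable_topology}"
  assumes "f \<in> borel_measurable borel"
  shows "(LINT x|lborel. f (x + c)) = (LINT x|lborel. f x)"
proof -
  have "(LINT x|lborel. f x) = (LINT x|distr lborel borel ((+) c). f x)"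
    by (simp add: lborel_distr_plus)
  also have "\<dots> = (LINT x|lborel. f (x + c))"
    using assms by (subst integral_distr) (simp_all add: add.commute)
  finally show ?thesis by simp
qed

lemma integrable_indicator_bounded:
  fixes f :: "'a::euclidean_space \<Rightarrow> 'b::{banach, second_countable_topology}"
  assumes "f \<in> borel_measurable borel" "\<And>x. norm (f x) \<le> B" "A \<in> sets borel" "bounded A"
  shows "integrable lborel (\<lambda>x. indicator A x *\<^sub>R f x)"
proof (rule Bochner_Integration.integrable_bound)
  show "integrable lborel (\<lambda>x. indicator A x * B)"
    using assms emeasure_bounded_finite[OF \<open>bounded A\<close>]
    by (intro integrable_mult_left) (simp add: integrable_indicator_iff)
  show "(\<lambda>x. indicator A x *\<^sub>R f x) \<in> borel_measurable lborel" using assms by simp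
  show "AE x in lborel. norm (indicator A x *\<^sub>R f x) \<le> norm (indicator A x * B)"
    using order_trans[OF assms(2) abs_ge_self] by (simp add: indicator_def)
qed

lemma bounded_cell: "bounded (cell :: (real^'n) set)"
  by (rule bounded_subset[OF bounded_cbox[of 0 "\<chi> i. 2 * pi"]]) (auto simp: cell_def mem_box_cart less_imp_le)

lemma bounded_vimage_translate:
  fixes c :: "'a::real_normed_vector"
  assumes "bounded S"
  shows "bounded {x. x + c \<in> S}"
proof -
  obtain B where B: "\<And>x. x \<in> S \<Longrightarrow> norm x \<le> B" using assms by (auto simp: bounded_iff)
  have "norm x \<le> B + norm c" if "x + c \<in> S" for x
    using B[OF that] norm_triangle_ineq4[of "x + c" c] by simp
  then show ?thesis by (auto simp: bounded_iff)
qed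

lemma periodic_axis: "periodic f \<Longrightarrow> f (x + (2 * pi) *\<^sub>R axis j 1) = f x"
  by (auto simp: periodic_def axis_def)

text \<open>The translated cell sticks out of the original one on a single side. The protruding
  part, moved back by one period, fills exactly the gap left on the other side.\<close>

lemma integral_torus_translate:
  fixes f :: "real^'n \<Rightarrow> 'b::{banach, second_countable_topology}"
  assumes f: "f \<in> borel_measurable borel" "periodic f" "\<And>x. norm (f x) \<le> B" and h: "0 \<le> h" "h \<le> 2 * pi"
  shows "(LINT x|torus_measure. f (x + h *\<^sub>R axis j 1)) = (LINT x|torus_measure. f x)"
proof -
  let ?e = "axis j 1 :: real^'n"
  note [measurable] = f(1)
  \<comment> \<open>\<open>A\<close> is the part of the translated cell that stays,
    \<open>A'\<close> the part beyond \<open>2 * pi\<close>, and \<open>A''\<close> is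
    \<open>A'\<close> moved back by one period.\<close>
  define A where "A = {x :: real^'n. x - h *\<^sub>R ?e \<in> cell \<and> x $ j < 2 * pi}"
  define A' where "A' = {x :: real^'n. x - h *\<^sub>R ?e \<in> cell \<and> 2 * pi \<le> x $ j}"
  define A'' where "A'' = {x :: real^'n. x + (2 * pi - h) *\<^sub>R ?e \<in> cell \<and> 0 \<le> x $ j}"
  have [measurable]: "(\<lambda>x :: real^'n. x $ j) \<in> borel_measurable borel"
    by (intro borel_measurable_continuous_onI continuous_intros)
  have [measurable]: "A \<in> sets borel" "A' \<in> sets borel" "A'' \<in> sets borel"
    unfolding A_def A'_def A''_def by measurable
  have bd: "bounded A" "bounded A'" "bounded A''"
    using bounded_subset[OF bounded_vimage_translate[OF bounded_cell, of "- h *\<^sub>R ?e"], of A]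
      bounded_subset[OF bounded_vimage_translate[OF bounded_cell, of "- h *\<^sub>R ?e"], of A']
      bounded_subset[OF bounded_vimage_translate[OF bounded_cell, of "(2 * pi - h) *\<^sub>R ?e"], of A'']
    by (auto simp: A_def A'_def A''_def)
  note int = integrable_indicator_bounded[OF f(1,3)]
  have "(LINT x|lborel. indicator cell x *\<^sub>R f (x + h *\<^sub>R ?e)) =
      (LINT x|lborel. (\<lambda>y. indicator cell (y - h *\<^sub>R ?e) *\<^sub>R f y) (x + h *\<^sub>R ?e))"
    by simp
  also have "\<dots> = (LINT y|lborel. indicator cell (y - h *\<^sub>R ?e) *\<^sub>R f y)"
    by (rule lborel_integral_translate) simp
  also have "\<dots> = (LINT y|lborel. indicator A y *\<^sub>R f y + indicator A' y *\<^sub>R f y)"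
    by (intro Bochner_Integration.integral_cong refl) (auto simp: A_def A'_def indicator_def)
  also have "\<dots> = (LINT y|lborel. indicator A y *\<^sub>R f y) + (LINT y|lborel. indicator A' y *\<^sub>R f y)"
    by (intro Bochner_Integration.integral_add int bd) auto
  also have "(LINT y|lborel. indicator A' y *\<^sub>R f y) =
      (LINT y|lborel. indicator A' (y + (2 * pi) *\<^sub>R ?e) *\<^sub>R f (y + (2 * pi) *\<^sub>R ?e))"
    by (rule lborel_integral_translate[symmetric]) simp
  also have "\<dots> = (LINT y|lborel. indicator A'' y *\<^sub>R f y)"
    unfolding periodic_axis[OF f(2)]
    by (intro Bochner_Integration.integral_cong refl)
      (auto simp: A'_def A''_def indicator_def algebra_simps)
  also have "(LINT y|lborel. indicator A y *\<^sub>R f y) + (LINT y|lborel. indicator A'' y *\<^sub>R f y) =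
      (LINT y|lborel. indicator A y *\<^sub>R f y + indicator A'' y *\<^sub>R f y)"
    by (intro Bochner_Integration.integral_add[symmetric] int bd) auto
  also have "\<dots> = (LINT y|lborel. indicator cell y *\<^sub>R f y)"
  proof (intro Bochner_Integration.integral_cong refl)
    fix y :: "real^'n"
    have A: "y \<in> A \<longleftrightarrow> (\<forall>i. i \<noteq> j \<longrightarrow> 0 \<le> y $ i \<and> y $ i < 2 * pi) \<and> h \<le> y $ j \<and> y $ j < 2 * pi"
      using h unfolding A_def cell_def mem_Collect_eq by (auto simp: axis_def)
    have A'': "y \<in> A'' \<longleftrightarrow> (\<forall>i. i \<noteq> j \<longrightarrow> 0 \<le> y $ i \<and> y $ i < 2 * pi) \<and> 0 \<le> y $ j \<and> y $ j < h"
      using h unfolding A''_def cell_def mem_Collect_eq by (auto simp: axis_def)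
    have c: "y \<in> cell \<longleftrightarrow> (\<forall>i. i \<noteq> j \<longrightarrow> 0 \<le> y $ i \<and> y $ i < 2 * pi) \<and> 0 \<le> y $ j \<and> y $ j < 2 * pi"
      unfolding cell_def mem_Collect_eq by metis
    show "indicator A y *\<^sub>R f y + indicator A'' y *\<^sub>R f y = indicator cell y *\<^sub>R f y"
      using h A A'' c by (cases "y $ j < h") (auto simp: indicator_def)
  qed
  finally show ?thesis
    by (simp add: integral_torus_measure)
qed


section \<open>Periodic functions and their derivatives\<close>

lemma periodic_cell:
  assumes "periodic (f :: real^'n \<Rightarrow> 'b)"
  shows "\<exists>y\<in>cell. f x = f y"
proof -
  define k :: "real^'n" where "k = (\<chi> i. - of_int \<lfloor>x $ i / (2 * pi)\<rfloor>)"
  have "f (x + (2 * pi) *\<^sub>R k) = f x"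
    using assms by (simp add: periodic_def k_def)
  moreover have "x + (2 * pi) *\<^sub>R k \<in> cell"
    unfolding cell_def
  proof (intro CollectI allI)
    fix i
    show "0 \<le> (x + (2 * pi) *\<^sub>R k) $ i \<and> (x + (2 * pi) *\<^sub>R k) $ i < 2 * pi"
      using floor_divide_lower[of "2 * pi" "x $ i"] floor_divide_upper[of "2 * pi" "x $ i"]
      by (simp add: k_def algebra_simps)
  qed
  ultimately show ?thesis by metis
qed

lemma periodic_continuous_bounded:
  fixes f :: "real^'n \<Rightarrow> 'b::real_normed_vector"
  assumes "periodic f" "continuous_on UNIV f"
  obtains B where "\<And>x. norm (f x) \<le> B"
proof -
  have "compact (f ` cbox 0 (\<chi> i. 2 * pi))"
    using assms by (intro compact_continuous_image compact_cbox) (auto intro: continuous_on_subset)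
  then obtain B where B: "\<And>x. x \<in> cbox 0 (\<chi> i. 2 * pi) \<Longrightarrow> norm (f x) \<le> B"
    using compact_imp_bounded by (fastforce simp: bounded_iff)
  have "norm (f x) \<le> B" for x
  proof -
    obtain y where "y \<in> cell" "f x = f y" using periodic_cell[OF assms(1)] by blast
    then show ?thesis using B[of y] by (simp add: cell_def mem_box_cart less_imp_le)
  qed
  then show ?thesis by (rule that)
qed

text \<open>Translating by a period leaves \<open>f\<close> unchanged, so uniqueness of the
  derivative identifies the derivatives at both points.\<close>

lemma periodic_derivative:
  assumes "periodic f" "\<And>x. (f has_derivative f' x) (at x)"
  shows "periodic (\<lambda>x. f' x v)"
  unfolding periodic_def
proof (intro allI impI)
  fix x k :: "real^'a" assume k: "\<forall>i. k $ i \<in> \<int>"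
  have "(f has_derivative f' (x + (2 * pi) *\<^sub>R k)) (at (x + (2 * pi) *\<^sub>R k))"
    by (rule assms(2))
  then have "((\<lambda>y. f (y + (2 * pi) *\<^sub>R k)) has_derivative f' (x + (2 * pi) *\<^sub>R k)) (at x)"
    by (auto dest!: has_derivative_compose[of "\<lambda>y. y + (2 * pi) *\<^sub>R k" "\<lambda>y. y" x UNIV, rotated]
        intro!: derivative_eq_intros)
  moreover have "(\<lambda>y. f (y + (2 * pi) *\<^sub>R k)) = f"
    using assms(1) k by (auto simp: periodic_def)
  ultimately have "f' (x + (2 * pi) *\<^sub>R k) = f' x"
    using has_derivative_unique[OF assms(2)[of x]] by simp
  then show "f' (x + (2 * pi) *\<^sub>R k) v = f' x v" by simp
qed

text \<open>This is integration by parts in its basic form. Difference quotients integrate to 0 by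
  translation invariance; they converge to the derivative and, by the mean value inequality, are
  bounded by a bound of the derivative, so dominated convergence applies.\<close>

lemma integral_torus_derivative:
  fixes F :: "real^'n \<Rightarrow> complex"
  assumes der: "\<And>x. (F has_derivative F' x) (at x)" and per: "periodic F"
    and cont: "continuous_on UNIV (\<lambda>x. F' x (axis j 1))"
  shows "(LINT x|torus_measure. F' x (axis j 1)) = 0"
proof -
  let ?e = "axis j 1 :: real^'n"
  have contF: "continuous_on UNIV F"
    using der by (meson continuous_at_imp_continuous_on has_derivative_continuous)
  obtain B where B: "\<And>x. norm (F' x ?e) \<le> B"
    using periodic_continuous_bounded[OF periodic_derivative[OF per der] cont] by blast
  obtain C where C: "\<And>x. norm (F x) \<le> C"
    using periodic_continuous_bounded[OF per contF] by blast
  have meas: "F \<in> borel_measurable borel" "(\<lambda>x. F' x ?e) \<in> borel_measurable borel"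
    using contF cont by (simp_all add: borel_measurable_continuous_onI)
  have meas_t: "(\<lambda>x. F (x + t *\<^sub>R ?e)) \<in> borel_measurable borel" for t
    by (intro borel_measurable_continuous_onI continuous_intros continuous_on_compose2[OF contF]) auto
  define s where "s n x = (F (x + (1 / real (Suc n)) *\<^sub>R ?e) - F x) /\<^sub>R (1 / real (Suc n))" for n x
  interpret finite_measure "torus_measure :: (real^'n) measure" by (rule finite_measure_torus)
  have line: "((\<lambda>t. F (x + t *\<^sub>R ?e)) has_derivative (\<lambda>r. r *\<^sub>R F' (x + t *\<^sub>R ?e) ?e)) (at t)" for x t
  proof -
    have "((\<lambda>t. F (x + t *\<^sub>R ?e)) has_derivative (\<lambda>r. F' (x + t *\<^sub>R ?e) (r *\<^sub>R ?e))) (at t)"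
      by (rule has_derivative_compose[of "\<lambda>t. x + t *\<^sub>R ?e" _ _ _ F]) (auto intro!: derivative_eq_intros der)
    then show ?thesis
      by (simp add: linear_scale[OF has_derivative_linear[OF der]])
  qed
  have int_s: "(LINT x|torus_measure. s n x) = 0" for n
  proof -
    \<comment> \<open>The step sizes have to stay below one period for the translation
      lemma.\<close>
    have "1 / real (Suc n) \<le> 1" by simp
    moreover have "1 \<le> 2 * pi" using pi_gt3 by simp
    ultimately have h: "1 / real (Suc n) \<le> 2 * pi" by linarith
    have "integrable torus_measure F" "integrable torus_measure (\<lambda>x. F (x + (1 / real (Suc n)) *\<^sub>R ?e))"
      using C meas meas_t by (auto intro!: integrable_const_bound[of _ C])
    then show ?thesis
      using integral_torus_translate[OF meas(1) per C _ h, of j] by (simp add: s_def)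
  qed
  have "(\<lambda>n. LINT x|torus_measure. s n x) \<longlonglongrightarrow> (LINT x|torus_measure. F' x ?e)"
  proof (rule integral_dominated_convergence[where w = "\<lambda>_. B"])
    show "AE x in torus_measure. (\<lambda>n. s n x) \<longlonglongrightarrow> F' x ?e"
    proof (rule AE_I2)
      fix x
      have lim: "((\<lambda>t. norm (F (x + t *\<^sub>R ?e) - F x - t *\<^sub>R F' x ?e) / norm t) \<longlongrightarrow> 0) (at 0)"
        using line[of x 0] by (simp add: has_derivative_at)
      have eq: "norm (F (x + t *\<^sub>R ?e) - F x - t *\<^sub>R F' x ?e) / norm t =
          norm ((F (x + t *\<^sub>R ?e) - F x) /\<^sub>R t - F' x ?e)" if "t \<noteq> 0" for t
      proof -
        have "(F (x + t *\<^sub>R ?e) - F x) /\<^sub>R t - F' x ?e = (F (x + t *\<^sub>R ?e) - F x - t *\<^sub>R F' x ?e) /\<^sub>R t"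
          using that by (simp add: scaleR_diff_right)
        then show ?thesis by (simp add: divide_inverse mult.commute)
      qed
      have "((\<lambda>t. norm ((F (x + t *\<^sub>R ?e) - F x) /\<^sub>R t - F' x ?e)) \<longlongrightarrow> 0) (at 0)"
        by (rule Lim_transform_eventually[OF lim]) (simp add: eventually_at_filter eq[unfolded real_norm_def] always_eventually)
      then have "((\<lambda>t. (F (x + t *\<^sub>R ?e) - F x) /\<^sub>R t) \<longlongrightarrow> F' x ?e) (at 0)"
        by (simp add: tendsto_norm_zero_iff LIM_zero_iff)
      moreover have "filterlim (\<lambda>n. 1 / real (Suc n)) (at 0) sequentially"
        using LIMSEQ_Suc[OF lim_1_over_n[where 'a = real]] by (simp add: filterlim_at)
      ultimately show "(\<lambda>n. s n x) \<longlonglongrightarrow> F' x ?e"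
        unfolding s_def by (rule filterlim_compose)
    qed
    show "AE x in torus_measure. norm (s n x) \<le> B" for n
    proof (rule AE_I2)
      fix x
      define h where "h = 1 / real (Suc n)"
      have h: "0 < h" by (simp add: h_def)
      have "continuous_on {0..h} (\<lambda>t. F (x + t *\<^sub>R ?e))"
        by (intro continuous_intros continuous_on_compose2[OF contF]) auto
      then obtain t where "norm (F (x + h *\<^sub>R ?e) - F (x + 0 *\<^sub>R ?e)) \<le> norm ((h - 0) *\<^sub>R F' (x + t *\<^sub>R ?e) ?e)"
        using mvt_general[of 0 h "\<lambda>t. F (x + t *\<^sub>R ?e)" "\<lambda>t r. r *\<^sub>R F' (x + t *\<^sub>R ?e) ?e"] line h by blast
      also have "\<dots> \<le> h * B" using h B by (simp add: mult_left_mono)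
      finally have "norm (F (x + h *\<^sub>R ?e) - F x) / h \<le> B"
        using h by (simp add: pos_divide_le_eq mult.commute)
      moreover have "norm (s n x) = norm (F (x + h *\<^sub>R ?e) - F x) / h"
        unfolding s_def h_def[symmetric] norm_scaleR using h by (simp add: divide_inverse mult.commute)
      ultimately show "norm (s n x) \<le> B" by simp
    qed
    show "s n \<in> borel_measurable torus_measure" for n
      unfolding s_def using meas meas_t by simp
  qed (use meas in auto)
  then show ?thesis
    unfolding int_s by (simp add: LIMSEQ_const_iff)
qed

lemma square_integrable_continuous:
  assumes "periodic f" "continuous_on UNIV f"
  shows "square_integrable f"
proof -
  interpret finite_measure "torus_measure :: (real^'a) measure" by (rule finite_measure_torus)
  obtain B where "\<And>x. norm (f x) \<le> B" using periodic_continuous_bounded[OF assms] by blast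
  then have "norm ((norm (f x))\<^sup>2) \<le> B\<^sup>2" for x by (simp add: power_mono)
  moreover have "f \<in> borel_measurable borel" using assms(2) by (rule borel_measurable_continuous_onI)
  ultimately show ?thesis
    unfolding square_integrable_def using assms(1) by (auto intro!: integrable_const_bound[of _ "B\<^sup>2"])
qed

section \<open>The symbol of the Dirac operator\<close>

text \<open>Kept abstract in matrices and coefficients: it yields the symbol and, with adjoint
  matrices and conjugate coefficients, the adjoint symbol.\<close>

definition clifford_sum :: "('i::finite \<Rightarrow> complex^'m^'m) \<Rightarrow> ('i \<Rightarrow> complex) \<Rightarrow> complex^'m \<Rightarrow> complex^'m" where
  "clifford_sum G c v = (\<Sum>j\<in>UNIV. c j *s (G j *v v))"

lemma matrix_vector_mult_sum_right: "A *v sum f S = (\<Sum>i\<in>S. A *v f i)" for A :: "complex^'m^'n"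
  by (induction S rule: infinite_finite_induct) (simp_all add: matrix_vector_right_distrib)

lemma matrix_vector_mult_smult: "A *v (c *s v) = c *s (A *v v)" for A :: "complex^'m^'n"
  by (simp add: vec_eq_iff matrix_vector_mult_def sum_distrib_left mult_ac)

lemma smult_sum_right: "c *s sum f S = (\<Sum>i\<in>S. c *s f i)" for f :: "'i \<Rightarrow> complex^'n"
  by (induction S rule: infinite_finite_induct) (simp_all add: vector_add_ldistrib)

lemma smult_sum_left: "sum c S *s v = (\<Sum>i\<in>S. c i *s v)" for v :: "complex^'n"
  by (induction S rule: infinite_finite_induct) (simp_all add: vector_sadd_rdistrib)

lemma mat_mult_vector: "mat e *v v = e *s v" for v :: "complex^'n"
  by (simp add: vec_eq_iff matrix_vector_mult_def mat_def if_distrib[of "\<lambda>x. x * _"] cong: if_cong)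

lemma minus_matrix_mult_vector: "(- A) *v v = - (A *v v)" for v :: "complex^'n"
  by (simp add: vec_eq_iff matrix_vector_mult_def sum_negf)

lemma clifford_sum_add: "clifford_sum G c (v + w) = clifford_sum G c v + clifford_sum G c w"
  by (simp add: clifford_sum_def matrix_vector_right_distrib vector_add_ldistrib sum.distrib)

lemma clifford_sum_smult: "clifford_sum G c (a *s v) = a *s clifford_sum G c v"
  by (simp add: clifford_sum_def matrix_vector_mult_smult smult_sum_right vector_smult_assoc mult.commute)

text \<open>In the double sum the terms with \<open>i \<noteq> j\<close> cancel in pairs, which is made visible by adding it to
  its transpose.\<close>

lemma clifford_sum_square:
  assumes anti: "\<And>i j. i \<noteq> j \<Longrightarrow> G i ** G j = - (G j ** G i)" and sq: "\<And>i. G i ** G i = mat (e i)"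
  shows "clifford_sum G c (clifford_sum G c v) = (\<Sum>j\<in>UNIV. (c j)\<^sup>2 * e j) *s v"
proof -
  define X where "X i j = (c i * c j) *s (G i *v (G j *v v))" for i j
  have X: "X i j + X j i = (if i = j then (2 * (c i)\<^sup>2 * e i) *s v else 0)" for i j
  proof (cases "i = j")
    case True
    then show ?thesis
      by (simp add: X_def matrix_vector_mul_assoc sq mat_mult_vector vector_smult_assoc power2_eq_square
          mult_ac vector_sadd_rdistrib[symmetric])
  next
    case False
    then show ?thesis
      by (simp add: X_def matrix_vector_mul_assoc anti[OF False] minus_matrix_mult_vector mult.commute)
  qed
  have S: "clifford_sum G c (clifford_sum G c v) = (\<Sum>i\<in>UNIV. \<Sum>j\<in>UNIV. X i j)"
    by (simp add: clifford_sum_def X_def matrix_vector_mult_sum_right matrix_vector_mult_smult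
        smult_sum_right vector_smult_assoc)
  let ?S = "\<Sum>i\<in>UNIV. \<Sum>j\<in>UNIV. X i j"
  have "?S + ?S = ?S + (\<Sum>i\<in>UNIV. \<Sum>j\<in>UNIV. X j i)"
    by (subst (2) sum.swap) simp
  also have "\<dots> = (\<Sum>i\<in>UNIV. \<Sum>j\<in>UNIV. X i j + X j i)"
    by (simp add: sum.distrib)
  also have "\<dots> = (\<Sum>i\<in>UNIV. (2 * (c i)\<^sup>2 * e i) *s v)"
    by (simp add: X)
  also have "\<dots> = (2 :: complex) *s ((\<Sum>j\<in>UNIV. (c j)\<^sup>2 * e j) *s v)"
    by (simp add: vector_smult_assoc smult_sum_left[symmetric] sum_distrib_left mult.assoc)
  finally have "?S $ a + ?S $ a = 2 * (((\<Sum>j\<in>UNIV. (c j)\<^sup>2 * e j) *s v) $ a)" for a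
    unfolding vec_eq_iff by simp
  then show ?thesis
    unfolding S vec_eq_iff by (simp flip: mult_2)
qed

definition cadjoint :: "complex^'n^'m \<Rightarrow> complex^'m^'n" where
  "cadjoint A = (\<chi> a b. cnj (A $ b $ a))"

lemma cadjoint_mult: "cadjoint (A ** B) = cadjoint B ** cadjoint A"
  by (simp add: cadjoint_def vec_eq_iff matrix_matrix_mult_def mult.commute)

lemma cadjoint_uminus: "cadjoint (- A) = - cadjoint A"
  by (simp add: cadjoint_def vec_eq_iff)

lemma cadjoint_mat: "cadjoint (mat e) = mat (cnj e)"
  by (simp add: cadjoint_def vec_eq_iff mat_def)

lemma spinor_cinner_cadjoint: "spinor_cinner (A *v v) w = spinor_cinner v (cadjoint A *v w)"
  by (simp add: spinor_cinner_def matrix_vector_mult_def cadjoint_def sum_distrib_left sum_distrib_right mult_ac)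
    (rule sum.swap)

lemma spinor_cinner_smult_left: "spinor_cinner (c *s v) w = c * spinor_cinner v w"
  by (simp add: spinor_cinner_def sum_distrib_left mult_ac)

lemma spinor_cinner_smult_right: "spinor_cinner v (c *s w) = cnj c * spinor_cinner v w"
  by (simp add: spinor_cinner_def sum_distrib_left mult_ac)

lemma spinor_cinner_add_left: "spinor_cinner (u + v) w = spinor_cinner u w + spinor_cinner v w"
  by (simp add: spinor_cinner_def distrib_right sum.distrib)

lemma spinor_cinner_add_right: "spinor_cinner u (v + w) = spinor_cinner u v + spinor_cinner u w"
  by (simp add: spinor_cinner_def distrib_left sum.distrib)

lemma spinor_cinner_sum_left: "spinor_cinner (sum f S) w = (\<Sum>i\<in>S. spinor_cinner (f i) w)"
  by (induction S rule: infinite_finite_induct) (simp_all add: spinor_cinner_add_left, simp_all add: spinor_cinner_def)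

lemma spinor_cinner_sum_right: "spinor_cinner w (sum f S) = (\<Sum>i\<in>S. spinor_cinner w (f i))"
  by (induction S rule: infinite_finite_induct) (simp_all add: spinor_cinner_add_right, simp_all add: spinor_cinner_def)

lemma scaleR_spinor: "r *\<^sub>R v = complex_of_real r *s (v :: complex^'m)"
  by (simp add: vec_eq_iff scaleR_conv_of_real[where 'a = complex])

text \<open>Supplies the product rule and the continuity of pairings of spinor fields.\<close>

lemma bounded_bilinear_spinor_cinner: "bounded_bilinear (spinor_cinner :: 'n spinor \<Rightarrow> 'n spinor \<Rightarrow> complex)"
proof
  show "\<exists>K. \<forall>v w. norm (spinor_cinner v (w :: 'n spinor)) \<le> norm v * norm w * K"
  proof (intro exI allI)
    fix v w :: "'n spinor"
    have "norm (spinor_cinner v w) \<le> (\<Sum>a\<in>UNIV. norm (v $ a * cnj (w $ a)))"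
      unfolding spinor_cinner_def by (rule norm_sum)
    also have "\<dots> \<le> (\<Sum>a\<in>(UNIV :: 'n spin_index set). norm v * norm w)"
      by (intro sum_mono) (simp add: norm_mult mult_mono Finite_Cartesian_Product.norm_nth_le)
    finally show "norm (spinor_cinner v w) \<le> norm v * norm w * real CARD('n spin_index)"
      by (simp add: mult.commute)
  qed
qed (simp_all add: spinor_cinner_add_left spinor_cinner_add_right scaleR_spinor spinor_cinner_smult_left
    spinor_cinner_smult_right scaleR_conv_of_real)

lemma bounded_linear_smult_left: "bounded_linear (\<lambda>c. c *s (v :: complex^'m))"
  by (rule bounded_linear_intro[of _ "norm v"])
    (simp_all add: vector_sadd_rdistrib norm_smult_spinor scaleR_spinor vector_smult_assoc scaleR_conv_of_real)

lemma bounded_linear_matrix_vector: "bounded_linear (\<lambda>v. A *v (v :: complex^'m))" for A :: "complex^'m^'n"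
  unfolding linear_conv_bounded_linear[symmetric]
  by (rule linearI) (simp_all add: matrix_vector_right_distrib scaleR_spinor matrix_vector_mult_smult)

section \<open>The metric form and the Dirac symbol\<close>

definition metric_sign :: "nat \<Rightarrow> 'n::{finite,linorder} \<Rightarrow> real" where
  "metric_sign p j = (if pos j \<le> p then - 1 else 1)"

lemma pq_form_eq: "pq_form p x y = (\<Sum>j\<in>UNIV. metric_sign p j * x $ j * y $ j)"
proof -
  have "(\<Sum>j\<in>UNIV. metric_sign p j * x $ j * y $ j) =
      (\<Sum>j\<in>UNIV. if pos j \<le> p then - (x $ j * y $ j) else x $ j * y $ j)"
    by (intro sum.cong) (auto simp: metric_sign_def)
  also have "\<dots> = pq_form p x y"
    by (simp add: pq_form_def sum.If_cases sum_negf not_le Compl_eq)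
  finally show ?thesis by simp
qed

lemma pq_form_axis: "pq_form p (axis j 1) (axis j 1) = metric_sign p j"
  by (simp add: pq_form_eq axis_def if_distrib cong: if_cong)

lemma clifford_mult_axis: "clifford_mult p (axis j 1) v = gamma_mat p j *v v"
proof -
  have "clifford_mult p (axis j 1) v = (\<Sum>i\<in>UNIV. if i = j then gamma_mat p j *v v else 0)"
    unfolding clifford_mult_def by (intro sum.cong) (auto simp: axis_def)
  then show ?thesis by simp
qed

text \<open>Differentiating the wave in direction \<open>j\<close> contributes \<i> times
  \<open>k $ j\<close>; the metric sign is the factor in front of that term in the Dirac
  operator.\<close>

definition symbol_coeff :: "nat \<Rightarrow> real^'n::{finite,linorder} \<Rightarrow> 'n \<Rightarrow> complex" where
  "symbol_coeff p k j = \<i> * complex_of_real (metric_sign p j * k $ j)"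

definition dirac_symbol :: "nat \<Rightarrow> real^'n::{finite,linorder} \<Rightarrow> 'n spinor \<Rightarrow> 'n spinor" where
  "dirac_symbol p k = clifford_sum (gamma_mat p) (symbol_coeff p k)"

definition dirac_symbol_adj :: "nat \<Rightarrow> real^'n::{finite,linorder} \<Rightarrow> 'n spinor \<Rightarrow> 'n spinor" where
  "dirac_symbol_adj p k = clifford_sum (\<lambda>j. cadjoint (gamma_mat p j)) (\<lambda>j. cnj (symbol_coeff p k j))"

lemma gamma_mat_square': "gamma_mat p i ** gamma_mat p i = mat (complex_of_real (- metric_sign p i))"
  by (simp add: gamma_mat_square metric_sign_def)

text \<open>The sign from squaring \<i> cancels the sign in the square of \<open>gamma_mat\<close>,
  and of the three metric signs two cancel, which leaves the quadratic form.\<close>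

lemma dirac_symbol_square:
  "dirac_symbol p k (dirac_symbol p k v) = complex_of_real (pq_form p k k) *s v"
proof -
  have "(symbol_coeff p k j)\<^sup>2 * complex_of_real (- metric_sign p j) = complex_of_real (metric_sign p j * k $ j * k $ j)" for j
    by (simp add: symbol_coeff_def metric_sign_def power_mult_distrib flip: power2_eq_square)
  then show ?thesis
    unfolding dirac_symbol_def
    by (subst clifford_sum_square[OF gamma_mat_anticommute gamma_mat_square']) (simp_all add: pq_form_eq)
qed

text \<open>Adjoints reverse products, so anticommutation and squares persist; the scalars are real
  and survive conjugation.\<close>

lemma dirac_symbol_adj_square:
  "dirac_symbol_adj p k (dirac_symbol_adj p k v) = complex_of_real (pq_form p k k) *s v"
proof -
  have *: "(cnj (symbol_coeff p k j))\<^sup>2 * complex_of_real (- metric_sign p j) = complex_of_real (metric_sign p j * k $ j * k $ j)" for j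
    by (simp add: symbol_coeff_def metric_sign_def power_mult_distrib flip: power2_eq_square)
  show ?thesis
    unfolding dirac_symbol_adj_def
  proof (subst clifford_sum_square)
    show "cadjoint (gamma_mat p i) ** cadjoint (gamma_mat p j) = - (cadjoint (gamma_mat p j) ** cadjoint (gamma_mat p i))"
      if "i \<noteq> j" for i j
      unfolding cadjoint_mult[symmetric]
      by (simp add: cadjoint_uminus gamma_mat_anticommute[OF that[symmetric]])
    show "cadjoint (gamma_mat p i) ** cadjoint (gamma_mat p i) = mat (complex_of_real (- metric_sign p i))" for i
      unfolding cadjoint_mult[symmetric] gamma_mat_square' cadjoint_mat by simp
  qed (simp only: * pq_form_eq of_real_sum)
qed

lemma spinor_cinner_dirac_symbol:
  "spinor_cinner (dirac_symbol p k v) w = spinor_cinner v (dirac_symbol_adj p k w)"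
  by (simp add: dirac_symbol_def dirac_symbol_adj_def clifford_sum_def spinor_cinner_sum_left
      spinor_cinner_sum_right spinor_cinner_smult_left spinor_cinner_smult_right spinor_cinner_cadjoint)

section \<open>Plane waves\<close>

definition integral_vec :: "real^'n \<Rightarrow> bool" where
  "integral_vec k \<longleftrightarrow> (\<forall>i. k $ i \<in> \<int>)"

definition plane_wave :: "real^'n \<Rightarrow> complex^'m \<Rightarrow> real^'n \<Rightarrow> complex^'m" where
  "plane_wave k v x = cis (k \<bullet> x) *s v"

lemma has_derivative_plane_wave:
  "(plane_wave k v has_derivative (\<lambda>h. plane_wave k ((\<i> * complex_of_real (k \<bullet> h)) *s v) x)) (at x)"
proof -
  have "((\<lambda>x. cis (k \<bullet> x)) has_derivative (\<lambda>h. (k \<bullet> h) *\<^sub>R (\<i> * cis (k \<bullet> x)))) (at x)"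
    by (auto intro!: derivative_eq_intros)
  from bounded_linear.has_derivative[OF bounded_linear_smult_left[of v] this] show ?thesis
    by (simp add: plane_wave_def[abs_def] vector_smult_assoc scaleR_conv_of_real mult_ac)
qed

lemma frechet_derivative_plane_wave:
  "frechet_derivative (plane_wave k v) (at x) h = plane_wave k ((\<i> * complex_of_real (k \<bullet> h)) *s v) x"
  using frechet_derivative_at[OF has_derivative_plane_wave, symmetric] by metis

lemma continuous_on_plane_wave: "continuous_on S (plane_wave k v)"
  using has_derivative_plane_wave has_derivative_continuous continuous_at_imp_continuous_on by metis

text \<open>Directional derivatives of a plane wave are plane waves of the same frequency with
  another amplitude, so the induction runs over all amplitudes.\<close>

lemma smooth_plane_wave: "smooth (plane_wave k v)"
proof -
  have "Ck m (plane_wave k v)" for m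
  proof (induction m arbitrary: v)
    case 0
    then show ?case by (simp add: continuous_on_plane_wave)
  next
    case (Suc m)
    have "plane_wave k v differentiable at x" for x
      using has_derivative_plane_wave by (rule differentiableI)
    then show ?case
      using Suc by (simp add: frechet_derivative_plane_wave)
  qed
  then show ?thesis by (simp add: smooth_def)
qed

lemma periodic_plane_wave:
  assumes "integral_vec k"
  shows "periodic (plane_wave k v)"
  unfolding periodic_def
proof (intro allI impI)
  fix x l :: "real^'a" assume l: "\<forall>i. l $ i \<in> \<int>"
  have "k \<bullet> l \<in> \<int>"
    using assms l by (auto simp: integral_vec_def inner_vec_def intro!: Ints_sum Ints_mult)
  then obtain n where n: "k \<bullet> l = of_int n" by (auto elim: Ints_cases)
  have "cis (k \<bullet> (x + (2 * pi) *\<^sub>R l)) = cis (k \<bullet> x) * cis (2 * pi * of_int n)"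
    by (simp only: inner_add_right inner_scaleR_right n cis_mult)
  also have "\<dots> = cis (k \<bullet> x)"
    by (simp only: cis_multiple_2pi Ints_of_int mult_1_right)
  finally show "plane_wave k v (x + (2 * pi) *\<^sub>R l) = plane_wave k v x"
    by (simp add: plane_wave_def)
qed

lemma plane_wave_smooth_spinors: "integral_vec k \<Longrightarrow> plane_wave k v \<in> smooth_spinors"
  by (simp add: smooth_spinors_def smooth_plane_wave periodic_plane_wave)

lemma square_integrable_plane_wave: "integral_vec k \<Longrightarrow> square_integrable (plane_wave k v)"
  by (simp add: square_integrable_continuous continuous_on_plane_wave periodic_plane_wave)

lemma dirac_diff_eq:
  "dirac_diff p \<psi> x = (\<Sum>j\<in>UNIV. complex_of_real (metric_sign p j) *s
     (gamma_mat p j *v frechet_derivative \<psi> (at x) (axis j 1)))"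
  by (simp add: dirac_diff_def pq_form_axis clifford_mult_axis scaleR_spinor)

lemma dirac_diff_plane_wave: "dirac_diff p (plane_wave k v) = plane_wave k (dirac_symbol p k v)"
  by (rule ext)
    (simp add: dirac_diff_eq frechet_derivative_plane_wave dirac_symbol_def clifford_sum_def symbol_coeff_def
      plane_wave_def smult_sum_right vector_smult_assoc matrix_vector_mult_smult inner_axis mult_ac)

section \<open>Weak action of the Dirac operator on smooth spinors\<close>

lemma smooth_spinors_has_derivative:
  assumes "\<psi> \<in> smooth_spinors"
  shows "(\<psi> has_derivative frechet_derivative \<psi> (at x)) (at x)"
    and "continuous_on UNIV \<psi>"
    and "continuous_on UNIV (\<lambda>x. frechet_derivative \<psi> (at x) h)"
proof -
  have "Ck (Suc 0) \<psi>" "Ck 0 \<psi>" using assms by (auto simp: smooth_spinors_def smooth_def simp del: Ck.simps)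
  then show "(\<psi> has_derivative frechet_derivative \<psi> (at x)) (at x)" "continuous_on UNIV \<psi>"
    "continuous_on UNIV (\<lambda>x. frechet_derivative \<psi> (at x) h)"
    by (auto simp: frechet_derivative_works)
qed

lemma square_integrable_smooth:
  assumes "\<psi> \<in> smooth_spinors"
  shows "square_integrable \<psi>" "square_integrable (dirac_diff p \<psi>)"
proof -
  have per: "periodic \<psi>" using assms by (simp add: smooth_spinors_def)
  note d = smooth_spinors_has_derivative[OF assms]
  show "square_integrable \<psi>" using per d by (simp add: square_integrable_continuous)
  show "square_integrable (dirac_diff p \<psi>)"
  proof (rule square_integrable_continuous)
    show "periodic (dirac_diff p \<psi>)"
      using periodic_derivative[OF per d(1)] by (simp add: periodic_def dirac_diff_def)
    show "continuous_on UNIV (dirac_diff p \<psi>)"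
      unfolding dirac_diff_eq scaleR_spinor[symmetric]
      by (intro continuous_intros bounded_linear.continuous_on[OF bounded_linear_matrix_vector] d(3))
  qed
qed

lemma integral_spinor_derivative:
  fixes \<psi> :: "real^'n::finite \<Rightarrow> 'n spinor"
  assumes "\<psi> \<in> smooth_spinors" "integral_vec k"
  shows "(LINT x|torus_measure. spinor_cinner (A *v frechet_derivative \<psi> (at x) (axis j 1)) (plane_wave k w x)) =
    \<i> * complex_of_real (k $ j) * (LINT x|torus_measure. spinor_cinner (A *v \<psi> x) (plane_wave k w x))"
proof -
  note d = smooth_spinors_has_derivative[OF assms(1)]
  have per: "periodic \<psi>" "periodic (plane_wave k w)" using assms by (simp_all add: smooth_spinors_def periodic_plane_wave)
  let ?D = "\<lambda>x. frechet_derivative \<psi> (at x) (axis j 1)"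
  let ?c = "\<i> * complex_of_real (k $ j)"
  define F where "F x = spinor_cinner (A *v \<psi> x) (plane_wave k w x)" for x
  define F' where "F' x h = spinor_cinner (A *v \<psi> x) (plane_wave k ((\<i> * complex_of_real (k \<bullet> h)) *s w) x)
    + spinor_cinner (A *v frechet_derivative \<psi> (at x) h) (plane_wave k w x)" for x h
  have der: "(F has_derivative F' x) (at x)" for x
    unfolding F_def F'_def
    by (intro bounded_bilinear.FDERIV[OF bounded_bilinear_spinor_cinner] bounded_linear.has_derivative[OF bounded_linear_matrix_vector] d(1) has_derivative_plane_wave)
  have perF: "periodic F" using per by (simp add: periodic_def F_def)
  \<comment> \<open>The second argument of the pairing is conjugate linear, so differentiating the
    wave contributes \<open>- ?c\<close>.\<close>
  have F'_axis: "F' x (axis j 1) = spinor_cinner (A *v ?D x) (plane_wave k w x) - ?c * F x" for x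
    by (simp add: F'_def F_def inner_axis plane_wave_def spinor_cinner_smult_right)
  have cont: "continuous_on UNIV (\<lambda>x. F' x (axis j 1))" "continuous_on UNIV F"
    unfolding F'_def F_def
    by (intro continuous_intros bounded_bilinear.continuous_on[OF bounded_bilinear_spinor_cinner] bounded_linear.continuous_on[OF bounded_linear_matrix_vector]
        d continuous_on_plane_wave)+
  have int: "integrable torus_measure f" if f: "periodic f" "continuous_on UNIV f" for f :: "real^'n \<Rightarrow> complex"
  proof -
    interpret finite_measure "torus_measure :: (real^'n) measure" by (rule finite_measure_torus)
    obtain B where "\<And>x. norm (f x) \<le> B" using periodic_continuous_bounded[OF f] by blast
    then show ?thesis using f by (auto intro!: integrable_const_bound[of _ B]
        simp: borel_measurable_continuous_onI measurable_cong_sets[OF sets_torus_measure refl])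
  qed
  have "(LINT x|torus_measure. spinor_cinner (A *v ?D x) (plane_wave k w x)) =
      (LINT x|torus_measure. F' x (axis j 1) + ?c * F x)"
    by (simp add: F'_axis)
  also have "\<dots> = (LINT x|torus_measure. F' x (axis j 1)) + ?c * (LINT x|torus_measure. F x)"
    using int[OF perF cont(2)] int[OF periodic_derivative[OF perF der] cont(1)] by simp
  also have "(LINT x|torus_measure. F' x (axis j 1)) = 0"
    by (rule integral_torus_derivative[OF der perF cont(1)])
  finally show ?thesis by (simp add: F_def)
qed


text \<open>Against a wave of frequency \<open>k\<close> each partial derivative may be replaced by
  its Fourier factor. The operator thereby becomes the symbol at \<open>k\<close>, a matrix, whose
  adjoint moves to the amplitude.\<close>

lemma dirac_diff_symmetry:
  fixes \<psi> :: "real^'n::{finite,linorder} \<Rightarrow> 'n spinor"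
  assumes \<psi>: "\<psi> \<in> smooth_spinors" and k: "integral_vec k"
  shows "(LINT x|torus_measure. spinor_cinner (dirac_diff p \<psi> x) (plane_wave k w x)) =
    (LINT x|torus_measure. spinor_cinner (\<psi> x) (plane_wave k (dirac_symbol_adj p k w) x))"
proof -
  note d = smooth_spinors_has_derivative[OF \<psi>]
  have per: "periodic \<psi>" using \<psi> by (simp add: smooth_spinors_def)
  have int: "integrable torus_measure (\<lambda>x. spinor_cinner (A *v f x) (plane_wave k w x))"
    if "periodic f" "continuous_on UNIV f" for A and f :: "real^'n::{finite,linorder} \<Rightarrow> 'n spinor"
    using that k by (intro integrable_cinner square_integrable_plane_wave square_integrable_continuous
        bounded_linear.continuous_on[OF bounded_linear_matrix_vector]) (auto simp: periodic_def)
  have "(LINT x|torus_measure. spinor_cinner (dirac_diff p \<psi> x) (plane_wave k w x)) =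
      (LINT x|torus_measure. (\<Sum>j\<in>UNIV. complex_of_real (metric_sign p j) *
        spinor_cinner (gamma_mat p j *v frechet_derivative \<psi> (at x) (axis j 1)) (plane_wave k w x)))"
    by (simp add: dirac_diff_eq spinor_cinner_sum_left spinor_cinner_smult_left)
  also have "\<dots> = (\<Sum>j\<in>UNIV. complex_of_real (metric_sign p j) *
      (\<i> * complex_of_real (k $ j) * (LINT x|torus_measure. spinor_cinner (gamma_mat p j *v \<psi> x) (plane_wave k w x))))"
    by (subst Bochner_Integration.integral_sum)
      (auto simp: integral_spinor_derivative[OF \<psi> k] intro!: integrable_mult_right int periodic_derivative[OF per d(1)] d(3))
  also have "\<dots> = (LINT x|torus_measure. (\<Sum>j\<in>UNIV. symbol_coeff p k j * spinor_cinner (gamma_mat p j *v \<psi> x) (plane_wave k w x)))"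
    by (subst Bochner_Integration.integral_sum)
      (auto simp: symbol_coeff_def mult_ac intro!: integrable_mult_right int per d(2))
  also have "\<dots> = (LINT x|torus_measure. spinor_cinner (dirac_symbol p k (\<psi> x)) (plane_wave k w x))"
    by (simp add: dirac_symbol_def clifford_sum_def spinor_cinner_sum_left spinor_cinner_smult_left)
  also have "\<dots> = (LINT x|torus_measure. spinor_cinner (\<psi> x) (plane_wave k (dirac_symbol_adj p k w) x))"
    by (simp add: spinor_cinner_dirac_symbol plane_wave_def dirac_symbol_adj_def clifford_sum_smult)
  finally show ?thesis .
qed

section \<open>Plane waves as elements of the Hilbert space\<close>

lemma L2_class_add:
  assumes "square_integrable f" "square_integrable g"
  shows "L2_class f + L2_class g = L2_class (\<lambda>x. f x + g x)"
  using assms by (intro plus_L2_spinor.abs_eq) auto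

lemma L2_class_scaleC:
  assumes "square_integrable f"
  shows "scaleC c (L2_class f) = L2_class (\<lambda>x. c *s f x)"
  using assms by (intro scaleC_L2_spinor.abs_eq) auto

lemma L2_class_cinner:
  assumes "square_integrable f" "square_integrable g"
  shows "cinner (L2_class f) (L2_class g) = (LINT x|torus_measure. spinor_cinner (f x) (g x))"
  using assms by (intro cinner_L2_spinor.abs_eq) auto

lemma L2_class_norm:
  assumes "square_integrable f"
  shows "(norm (L2_class f))\<^sup>2 = (LINT x|torus_measure. (norm (f x))\<^sup>2)"
proof -
  have "(norm (L2_class f))\<^sup>2 = Re (cinner (L2_class f) (L2_class f))"
    by (simp add: power2_norm_eq_inner inner_eq_Re_cinner)
  then show ?thesis
    using assms by (simp add: L2_class_cinner cinner_self del: of_real_power)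
qed

lemma L2_class_surj:
  obtains f where "square_integrable f" "u = L2_class f"
proof
  show "square_integrable (rep_L2 u)" using Quotient3_rep_reflp[OF Quotient3_L2_spinor, of u] by auto
  show "u = L2_class (rep_L2 u)" using Quotient3_abs_rep[OF Quotient3_L2_spinor, of u] by auto
qed

definition wave :: "real^'n \<Rightarrow> 'n spinor \<Rightarrow> 'n L2_spinor" where
  "wave k v = L2_class (plane_wave k v)"

lemma wave_add: "integral_vec k \<Longrightarrow> wave k v + wave k w = wave k (v + w)"
  by (simp add: wave_def L2_class_add square_integrable_plane_wave) (simp add: plane_wave_def[abs_def] vector_add_ldistrib)

lemma scaleC_wave: "integral_vec k \<Longrightarrow> scaleC c (wave k v) = wave k (c *s v)"
  by (simp add: wave_def L2_class_scaleC square_integrable_plane_wave) (simp add: plane_wave_def[abs_def] vector_smult_assoc mult.commute)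

text \<open>Characters have modulus 1 and the torus measure has mass 1, so for fixed
  \<open>k\<close> amplitudes embed isometrically. All later norm estimates thus take place in the
  finite-dimensional spinor space.\<close>

lemma norm_wave:
  assumes "integral_vec k"
  shows "norm (wave k v) = norm v"
proof -
  have "(norm (wave k v))\<^sup>2 = (norm v)\<^sup>2"
    unfolding wave_def L2_class_norm[OF square_integrable_plane_wave[OF assms]]
    by (simp add: plane_wave_def norm_smult_spinor integral_torus_measure_const del: lebesgue_integral_const)
  then show ?thesis by simp
qed

lemma wave_in_dirac: "integral_vec k \<Longrightarrow> (wave k v, wave k (dirac_symbol p k v)) \<in> dirac p"
  by (auto simp: dirac_def wave_def dirac_diff_plane_wave plane_wave_smooth_spinors intro!: exI[of _ "plane_wave k v"])

text \<open>The real inner product carries the full complex identity, since \<open>w\<close> may be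
  replaced by \<open>\<i> *s w\<close>.\<close>

lemma dirac_inner_wave:
  assumes "(x, y) \<in> dirac p" "integral_vec k"
  shows "inner y (wave k w) = inner x (wave k (dirac_symbol_adj p k w))"
  using assms by (auto simp: dirac_def wave_def inner_eq_Re_cinner L2_class_cinner
      square_integrable_smooth square_integrable_plane_wave dirac_diff_symmetry)

section \<open>Density of the plane waves\<close>

text \<open>Embeds the torus as a product of unit circles, so that polynomials in the real
  coordinates pull back to trigonometric polynomials.\<close>

definition circle_map :: "real^'n \<Rightarrow> complex^'n" where
  "circle_map x = (\<chi> i. cis (x $ i))"

inductive trig_poly :: "(real^'n \<Rightarrow> complex) \<Rightarrow> bool" where
  trig_poly_character: "integral_vec k \<Longrightarrow> trig_poly (\<lambda>x. c * cis (k \<bullet> x))"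
| trig_poly_add: "trig_poly f \<Longrightarrow> trig_poly g \<Longrightarrow> trig_poly (\<lambda>x. f x + g x)"

lemma integral_vec_0: "integral_vec 0"
  by (simp add: integral_vec_def)

lemma integral_vec_add: "integral_vec k \<Longrightarrow> integral_vec l \<Longrightarrow> integral_vec (k + l)"
  by (simp add: integral_vec_def)

lemma integral_vec_minus: "integral_vec k \<Longrightarrow> integral_vec (- k)"
  by (simp add: integral_vec_def)

lemma integral_vec_axis: "integral_vec (axis i 1)"
  by (simp add: integral_vec_def axis_def)

lemma trig_poly_const: "trig_poly (\<lambda>x. c)"
  using trig_poly_character[OF integral_vec_0, of c] by simp

text \<open>Multiplying characters adds their frequencies, and sums of integral vectors are
  integral.\<close>

lemma trig_poly_mult:
  assumes "trig_poly f" "trig_poly g"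
  shows "trig_poly (\<lambda>x. f x * g x)"
  using assms(1)
proof induction
  case (trig_poly_character k c)
  from assms(2) show ?case
  proof induction
    case (trig_poly_character l d)
    have "trig_poly (\<lambda>x. (c * d) * cis ((k + l) \<bullet> x))"
      using trig_poly_character \<open>integral_vec k\<close> by (intro trig_poly.trig_poly_character integral_vec_add)
    then show ?case by (simp add: inner_add_left cis_mult[symmetric] mult_ac)
  next
    case (trig_poly_add f g)
    then show ?case using trig_poly.trig_poly_add by (simp add: distrib_left)
  qed
next
  case (trig_poly_add f g)
  then show ?case using trig_poly.trig_poly_add by (simp add: distrib_right)
qed

lemma trig_poly_sum: "(\<And>b. b \<in> S \<Longrightarrow> trig_poly (f b)) \<Longrightarrow> trig_poly (\<lambda>x. \<Sum>b\<in>S. f b x)"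
  by (induction S rule: infinite_finite_induct) (simp_all add: trig_poly_const trig_poly_add)

lemma trig_poly_cos_sin: "trig_poly (\<lambda>x. complex_of_real (cos (x $ i)))" "trig_poly (\<lambda>x. complex_of_real (sin (x $ i)))"
proof -
  have k: "integral_vec (axis i 1)" "integral_vec (- axis i 1)"
    by (simp_all add: integral_vec_axis integral_vec_minus)
  have "trig_poly (\<lambda>x. 1 / 2 * cis (axis i 1 \<bullet> x) + 1 / 2 * cis (- axis i 1 \<bullet> x))"
    by (intro trig_poly_add trig_poly_character k)
  moreover have "1 / 2 * cis (axis i 1 \<bullet> x) + 1 / 2 * cis (- axis i 1 \<bullet> x) = complex_of_real (cos (x $ i))" for x
    by (simp add: inner_axis' complex_eq_iff)
  ultimately show "trig_poly (\<lambda>x. complex_of_real (cos (x $ i)))" by simp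
  have "trig_poly (\<lambda>x. - \<i> / 2 * cis (axis i 1 \<bullet> x) + \<i> / 2 * cis (- axis i 1 \<bullet> x))"
    by (intro trig_poly_add trig_poly_character k)
  moreover have "- \<i> / 2 * cis (axis i 1 \<bullet> x) + \<i> / 2 * cis (- axis i 1 \<bullet> x) = complex_of_real (sin (x $ i))" for x
    by (simp add: inner_axis' complex_eq_iff)
  ultimately show "trig_poly (\<lambda>x. complex_of_real (sin (x $ i)))" by simp
qed

lemma trig_poly_real_polynomial:
  assumes "real_polynomial_function P"
  shows "trig_poly (\<lambda>x. complex_of_real (P (circle_map x)))"
  using assms
proof induction
  case (linear f)
  \<comment> \<open>A real basis vector of the target is 1 or \<i> in one coordinate, so these
    coordinates of \<open>circle_map\<close> are cosines and sines.\<close>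
  have b: "trig_poly (\<lambda>x. complex_of_real (circle_map x \<bullet> b) * complex_of_real (f b))" if "b \<in> Basis" for b
  proof -
    from that obtain i u where "b = axis i u" "u \<in> Basis" unfolding Basis_vec_def by blast
    then have "trig_poly (\<lambda>x. complex_of_real (circle_map x \<bullet> b))"
      using trig_poly_cos_sin by (auto simp: inner_axis circle_map_def Basis_complex_def inner_complex_def)
    then show ?thesis by (intro trig_poly_mult trig_poly_const)
  qed
  have f: "f z = (\<Sum>b\<in>Basis. (z \<bullet> b) * f b)" for z
  proof -
    interpret bounded_linear f by fact
    have "f z = f (\<Sum>b\<in>Basis. (z \<bullet> b) *\<^sub>R b)" by (simp add: euclidean_representation)
    then show ?thesis by (simp add: sum scaleR)
  qed
  have "(\<lambda>x. complex_of_real (f (circle_map x))) =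
      (\<lambda>x. \<Sum>b\<in>Basis. complex_of_real (circle_map x \<bullet> b) * complex_of_real (f b))"
    by (rule ext, subst f) simp
  then show ?case using trig_poly_sum[of Basis, OF b] by simp
next
  case (const c)
  then show ?case by (simp add: trig_poly_const)
next
  case (add f g)
  then show ?case by (simp add: trig_poly_add)
next
  case (mult f g)
  then show ?case by (simp add: trig_poly_mult)
qed

text \<open>\<open>Arg2pi\<close> jumps across the positive real axis, but it takes its lowest value
  0 there, so its strict superlevel sets are open.\<close>

lemma Arg2pi_measurable [measurable]: "Arg2pi \<in> borel_measurable borel"
  unfolding borel_measurable_iff_greater by (auto intro: borel_open open_Arg2pi2pi_gt)

lemma continuous_trig_poly: "trig_poly f \<Longrightarrow> continuous_on UNIV f"
  by (induction rule: trig_poly.induct) (auto intro!: continuous_intros)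

lemma trig_poly_measurable: "Collect trig_poly \<subseteq> borel_measurable torus_measure"
  by (auto simp: measurable_cong_sets[OF sets_torus_measure refl] borel_measurable_continuous_onI continuous_trig_poly)

text \<open>Push the torus measure forward to the product of unit circles; on the fundamental cell the
  arguments of the coordinates recover the point.\<close>

lemma trig_poly_l2_dense_real:
  fixes u :: "real^'n \<Rightarrow> real"
  assumes u [measurable]: "u \<in> borel_measurable borel" and fin: "(\<integral>\<^sup>+x. ennreal ((u x)\<^sup>2) \<partial>torus_measure) < \<infinity>"
  shows "l2_adherent torus_measure (Collect trig_poly) (\<lambda>x. complex_of_real (u x))"
proof -
  let ?E = "circle_map :: real^'n \<Rightarrow> complex^'n"
  have contE: "continuous_on UNIV ?E"
    unfolding circle_map_def by (intro continuous_intros)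
  have [measurable]: "?E \<in> measurable torus_measure borel"
    using contE by (simp add: measurable_cong_sets[OF sets_torus_measure refl] borel_measurable_continuous_onI)
  define a :: "complex^'n \<Rightarrow> real^'n" where "a z = (\<chi> i. Arg2pi (z $ i))" for z
  have [measurable]: "a \<in> borel_measurable borel"
  proof (subst borel_measurable_euclidean_space, intro ballI)
    fix b :: "real^'n" assume "b \<in> Basis"
    then obtain i where b: "b = axis i 1" by (auto simp: Basis_vec_def)
    have [measurable]: "(\<lambda>z :: complex^'n. z $ i) \<in> borel_measurable borel"
      by (intro borel_measurable_continuous_onI continuous_intros)
    show "(\<lambda>z. a z \<bullet> b) \<in> borel_measurable borel"
      unfolding b a_def by (simp add: inner_axis)
  qed
  define M where "M = distr torus_measure borel ?E"
  have a: "AE x in torus_measure. a (?E x) = x"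
    using AE_torus_measure_cell
  proof eventually_elim
    case (elim x)
    then have "Arg2pi (cis (x $ i)) = x $ i" for i
      using Arg2pi_exp[of "\<i> * complex_of_real (x $ i)"] by (simp add: cell_def cis_conv_exp)
    then show ?case by (simp add: a_def circle_map_def vec_eq_iff)
  qed
  have "norm (?E x) \<le> real CARD('n)" for x
  proof -
    have "norm (?E x) \<le> (\<Sum>i\<in>(UNIV :: 'n set). norm (?E x $ i))" 
      unfolding norm_vec_def by (rule L2_set_le_sum) simp
    then show ?thesis by (simp add: circle_map_def)
  qed
  then have AE_M: "AE z in M. z \<in> cball 0 (real CARD('n))"
    unfolding M_def by (subst AE_distr_iff) auto
  have fin_M: "finite_measure M"
    unfolding M_def by (intro finite_measure.finite_measure_distr finite_measure_torus) simp
  have "(\<integral>\<^sup>+z. ennreal ((u (a z))\<^sup>2) \<partial>M) = (\<integral>\<^sup>+x. ennreal ((u (a (?E x)))\<^sup>2) \<partial>torus_measure)"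
    unfolding M_def by (rule nn_integral_distr) simp_all
  also have "\<dots> = (\<integral>\<^sup>+x. ennreal ((u x)\<^sup>2) \<partial>torus_measure)"
    using a by (intro nn_integral_cong_AE) auto
  finally have dense: "l2_adherent M (Collect real_polynomial_function) (\<lambda>z. u (a z))"
    using fin by (intro polynomials_l2_dense[OF fin_M _ compact_cball AE_M]) (simp_all add: M_def)
  show ?thesis
    unfolding l2_adherent_def
  proof (intro allI impI)
    fix e :: real assume "0 < e"
    then obtain P where P: "real_polynomial_function P" "(\<integral>\<^sup>+z. ennreal ((norm (u (a z) - P z))\<^sup>2) \<partial>M) \<le> ennreal e"
      using dense unfolding l2_adherent_def by blast
    have [measurable]: "P \<in> borel_measurable borel"
      using P(1) by (intro borel_measurable_continuous_onI) (simp add: continuous_on_polymonial_function real_polynomial_function_eq)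
    have "(\<integral>\<^sup>+x. ennreal ((norm (complex_of_real (u x) - complex_of_real (P (?E x))))\<^sup>2) \<partial>torus_measure) =
        (\<integral>\<^sup>+x. ennreal ((norm (u (a (?E x)) - P (?E x)))\<^sup>2) \<partial>torus_measure)"
      using a by (intro nn_integral_cong_AE) (auto simp flip: of_real_diff)
    also have "\<dots> = (\<integral>\<^sup>+z. ennreal ((norm (u (a z) - P z))\<^sup>2) \<partial>M)"
      unfolding M_def by (rule nn_integral_distr[symmetric]) simp_all
    finally have "(\<integral>\<^sup>+x. ennreal ((norm (complex_of_real (u x) - complex_of_real (P (?E x))))\<^sup>2) \<partial>torus_measure) \<le> ennreal e"
      using P(2) by simp
    then show "\<exists>g\<in>Collect trig_poly. (\<integral>\<^sup>+x. ennreal ((norm (complex_of_real (u x) - g x))\<^sup>2) \<partial>torus_measure) \<le> ennreal e"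
      using trig_poly_real_polynomial[OF P(1)] by (intro bexI[of _ "\<lambda>x. complex_of_real (P (?E x))"]) auto
  qed
qed

lemma trig_poly_l2_dense:
  fixes f :: "real^'n \<Rightarrow> complex"
  assumes f [measurable]: "f \<in> borel_measurable borel" and fin: "(\<integral>\<^sup>+x. ennreal ((norm (f x))\<^sup>2) \<partial>torus_measure) < \<infinity>"
  shows "l2_adherent torus_measure (Collect trig_poly) f"
proof -
  have le: "(Re (f x))\<^sup>2 \<le> (norm (f x))\<^sup>2" "(Im (f x))\<^sup>2 \<le> (norm (f x))\<^sup>2" for x
    by (simp_all add: cmod_power2)
  have "(\<integral>\<^sup>+x. ennreal ((Re (f x))\<^sup>2) \<partial>torus_measure) < \<infinity>" "(\<integral>\<^sup>+x. ennreal ((Im (f x))\<^sup>2) \<partial>torus_measure) < \<infinity>"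
    by (rule le_less_trans[OF nn_integral_mono fin], rule ennreal_leI, rule le)+
  then have R: "l2_adherent torus_measure (Collect trig_poly) (\<lambda>x. complex_of_real (Re (f x)))"
    and I: "l2_adherent torus_measure (Collect trig_poly) (\<lambda>x. complex_of_real (Im (f x)))"
    by (intro trig_poly_l2_dense_real; simp)+
  have m: "(\<lambda>x. complex_of_real (Re (f x))) \<in> borel_measurable torus_measure"
    "(\<lambda>x. complex_of_real (Im (f x))) \<in> borel_measurable torus_measure" by simp_all
  have "l2_adherent torus_measure (Collect trig_poly) (\<lambda>x. \<i> * complex_of_real (Im (f x)))"
    by (rule l2_adherent_bounded_linear[OF trig_poly_measurable m(2) bounded_linear_mult_right _ I])
      (simp add: trig_poly_mult trig_poly_const)
  with R m have "l2_adherent torus_measure (Collect trig_poly) (\<lambda>x. complex_of_real (Re (f x)) + \<i> * complex_of_real (Im (f x)))"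
    by (intro l2_adherent_add[OF trig_poly_measurable]) (auto simp: trig_poly_add)
  then show ?thesis by (simp flip: complex_eq)
qed

lemma L2_class_norm_diff:
  assumes "square_integrable f" "square_integrable g"
    and "(\<integral>\<^sup>+x. ennreal ((norm (f x - g x))\<^sup>2) \<partial>torus_measure) \<le> ennreal (e\<^sup>2)" "0 \<le> e"
  shows "norm (L2_class f - L2_class g) \<le> e"
proof -
  have sq: "square_integrable (\<lambda>x. f x - g x)"
    using square_integrable_add[OF assms(1) square_integrable_smult[OF assms(2), of "- 1"]] by (simp add: vector_sneg_minus1[symmetric])
  have "L2_class f - L2_class g = L2_class (\<lambda>x. f x - g x)"
    unfolding minus_L2_spinor_def uminus_L2_spinor_def
    using assms(1,2) square_integrable_smult[OF assms(2), of "- 1"]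
    by (simp add: L2_class_scaleC L2_class_add vector_sneg_minus1[symmetric])
  then have "ennreal ((norm (L2_class f - L2_class g))\<^sup>2) = ennreal (LINT x|torus_measure. (norm (f x - g x))\<^sup>2)"
    using L2_class_norm[OF sq] by simp
  also have "\<dots> = (\<integral>\<^sup>+x. ennreal ((norm (f x - g x))\<^sup>2) \<partial>torus_measure)"
    using sq by (intro nn_integral_eq_integral[symmetric]) (auto simp: square_integrable_def)
  finally have "(norm (L2_class f - L2_class g))\<^sup>2 \<le> e\<^sup>2"
    using assms(3) by (metis ennreal_le_iff zero_le_power2)
  then show ?thesis using assms(4) by (rule power2_le_imp_le)
qed

text \<open>Closure under sums suffices because amplitudes absorb complex scalars. In this form the
  lemma applies both to the range of the resolvent operator and to the orthogonal complement of a
  vector.\<close>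

lemma wave_span_dense:
  fixes S :: "'n::finite L2_spinor set"
  assumes waves: "\<And>k v. integral_vec k \<Longrightarrow> wave k v \<in> S" and add: "\<And>x y. x \<in> S \<Longrightarrow> y \<in> S \<Longrightarrow> x + y \<in> S"
  shows "closure S = UNIV"
proof -
  define F where "F = {g. square_integrable g \<and> L2_class g \<in> S}"
  have F_meas: "F \<subseteq> borel_measurable torus_measure"
    by (auto simp: F_def square_integrable_def measurable_cong_sets[OF sets_torus_measure refl])
  have F_add: "(\<lambda>x. f x + g x) \<in> F" if "f \<in> F" "g \<in> F" for f g
    using that add by (auto simp: F_def square_integrable_add simp flip: L2_class_add)
  have F_wave: "plane_wave k v \<in> F" if "integral_vec k" for k v
    using waves[OF that] that by (simp add: F_def square_integrable_plane_wave wave_def)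
  have trig_F: "(\<lambda>x. T x *s v) \<in> F" if "trig_poly T" for T and v :: "'n spinor"
    using that
  proof induction
    case (trig_poly_character k c)
    then show ?case
      using F_wave[of k "c *s v"] by (simp add: plane_wave_def[abs_def] vector_smult_assoc mult.commute)
  next
    case (trig_poly_add f g)
    then show ?case using F_add by (simp add: vector_sadd_rdistrib)
  qed
  have "u \<in> closure S" for u
    unfolding closure_approachable
  proof (intro allI impI)
    fix e :: real assume "0 < e"
    obtain f where f: "square_integrable f" "u = L2_class f" by (rule L2_class_surj)
    have [measurable]: "f \<in> borel_measurable borel" using f by (simp add: square_integrable_def)
    have comp [measurable]: "(\<lambda>x. f x $ a) \<in> borel_measurable borel" for a
    proof -
      have "continuous_on UNIV (\<lambda>v :: 'n spinor. v $ a)" by (intro continuous_intros)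
      then show ?thesis by (rule borel_measurable_continuous_on) simp
    qed
    have smult [measurable]: "(\<lambda>x. f x $ a *s v) \<in> borel_measurable borel" for a and v :: "'n spinor"
    proof -
      have "continuous_on UNIV (\<lambda>c. c *s v)"
        by (rule linear_continuous_on[OF bounded_linear_smult_left])
      then show ?thesis by (rule borel_measurable_continuous_on) simp
    qed
    have fin: "(\<integral>\<^sup>+x. ennreal ((norm (f x $ a))\<^sup>2) \<partial>torus_measure) < \<infinity>" for a
    proof -
      have "(\<integral>\<^sup>+x. ennreal ((norm (f x $ a))\<^sup>2) \<partial>torus_measure) \<le> (\<integral>\<^sup>+x. ennreal ((norm (f x))\<^sup>2) \<partial>torus_measure)"
        by (intro nn_integral_mono ennreal_leI power_mono Finite_Cartesian_Product.norm_nth_le) simp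
      also have "\<dots> < \<infinity>"
        using f(1) by (subst nn_integral_eq_integral) (auto simp: square_integrable_def)
      finally show ?thesis .
    qed
    \<comment> \<open>Scalar density is used for each spinor component separately and carried to the
      spinor space along a coordinate axis.\<close>
    have part: "l2_adherent torus_measure F (\<lambda>x. f x $ a *s axis a 1)" for a
      by (rule l2_adherent_bounded_linear[OF trig_poly_measurable _ bounded_linear_smult_left
            _ trig_poly_l2_dense[OF comp fin]]) (simp_all add: trig_F)
    have sum: "l2_adherent torus_measure F (\<lambda>x. \<Sum>a\<in>A. f x $ a *s axis a 1)" for A
    proof (induction A rule: infinite_finite_induct)
      case (insert a A)
      have "(\<lambda>x. \<Sum>a\<in>A. f x $ a *s axis a 1) \<in> borel_measurable torus_measure"
        by (intro borel_measurable_sum) simp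
      then have "l2_adherent torus_measure F (\<lambda>x. f x $ a *s axis a 1 + (\<Sum>a\<in>A. f x $ a *s axis a 1))"
        by (intro l2_adherent_add[OF F_meas _ _ F_add part insert.IH]) simp_all
      then show ?case
        using insert.hyps by simp
    next
      have "(\<lambda>x. 0) \<in> F" using F_wave[OF integral_vec_0, of 0] by (simp add: plane_wave_def[abs_def])
      then have 0: "l2_adherent torus_measure F (\<lambda>x. 0)"
        by (auto simp: l2_adherent_def intro!: bexI[of _ "\<lambda>x. 0"])
      case empty
      show ?case using 0 by simp
      case (infinite A)
      then show ?case using 0 by simp
    qed
    have "l2_adherent torus_measure F f"
      using sum[of UNIV] unfolding basis_expansion .
    moreover have "0 < (e / 2)\<^sup>2" using \<open>0 < e\<close> by simp
    ultimately obtain g where g: "g \<in> F" "(\<integral>\<^sup>+x. ennreal ((norm (f x - g x))\<^sup>2) \<partial>torus_measure) \<le> ennreal ((e / 2)\<^sup>2)"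
      unfolding l2_adherent_def by blast
    then have "norm (L2_class f - L2_class g) \<le> e / 2"
      using f \<open>0 < e\<close> by (intro L2_class_norm_diff) (auto simp: F_def)
    then have "dist (L2_class g) u < e"
      using \<open>0 < e\<close> f by (simp add: dist_norm norm_minus_commute)
    then show "\<exists>y\<in>S. dist y u < e"
      using g(1) by (auto simp: F_def)
  qed
  then show ?thesis by blast
qed

section \<open>The spectrum\<close>

lemma frechet_derivative_add:
  assumes "f differentiable at x" "g differentiable at x"
  shows "frechet_derivative (\<lambda>x. f x + g x) (at x) = (\<lambda>v. frechet_derivative f (at x) v + frechet_derivative g (at x) v)"
  using assms by (intro frechet_derivative_at[symmetric] has_derivative_add) (simp_all flip: frechet_derivative_works)

lemma Ck_add:
  "Ck m f \<Longrightarrow> Ck m g \<Longrightarrow> Ck m (\<lambda>x. f x + g x)"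
proof (induction m arbitrary: f g)
  case 0
  then show ?case by (auto intro: continuous_intros)
next
  case (Suc m)
  have "frechet_derivative (\<lambda>x. f x + g x) (at x) = (\<lambda>v. frechet_derivative f (at x) v + frechet_derivative g (at x) v)" for x
    using Suc.prems by (intro frechet_derivative_add) auto
  then show ?case
    using Suc by (auto intro!: differentiable_add)
qed

text \<open>Makes the range of \<open>l - D\<close> closed under sums, as the density criterion
  requires.\<close>

lemma dirac_add:
  assumes "(x, y) \<in> dirac p" "(x', y') \<in> dirac p"
  shows "(x + x', y + y') \<in> dirac p"
proof -
  obtain \<psi> \<phi> where \<psi>: "\<psi> \<in> smooth_spinors" "x = L2_class \<psi>" "y = L2_class (dirac_diff p \<psi>)"
    and \<phi>: "\<phi> \<in> smooth_spinors" "x' = L2_class \<phi>" "y' = L2_class (dirac_diff p \<phi>)"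
    using assms by (auto simp: dirac_def)
  have "(\<lambda>x. \<psi> x + \<phi> x) \<in> smooth_spinors"
    using \<psi>(1) \<phi>(1) by (auto simp: smooth_spinors_def smooth_def periodic_def Ck_add)
  moreover have "dirac_diff p (\<lambda>x. \<psi> x + \<phi> x) = (\<lambda>x. dirac_diff p \<psi> x + dirac_diff p \<phi> x)"
  proof
    fix x
    have "\<psi> differentiable at x" "\<phi> differentiable at x"
      using smooth_spinors_has_derivative(1) \<psi>(1) \<phi>(1) by (blast intro: differentiableI)+
    then show "dirac_diff p (\<lambda>x. \<psi> x + \<phi> x) x = dirac_diff p \<psi> x + dirac_diff p \<phi> x"
      by (simp add: dirac_diff_eq frechet_derivative_add matrix_vector_right_distrib vector_add_ldistrib sum.distrib)
  qed
  ultimately show ?thesis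
    using \<psi> \<phi> by (auto simp: dirac_def L2_class_add square_integrable_smooth intro!: exI[of _ "\<lambda>x. \<psi> x + \<phi> x"])
qed

section \<open>The resolvent on plane waves\<close>

lemma inner_scaleC_left: "inner (scaleC c x) y = inner x (scaleC (cnj c) (y :: 'a::complex_inner))"
proof -
  have "cinner (scaleC c x) y = cinner x (scaleC (cnj c) y)"
    by (subst (2) cinner_commute) (simp add: cinner_scaleC_left cinner_commute[of y x])
  then show ?thesis by (simp add: inner_eq_Re_cinner)
qed

lemma wave_0: "wave 0 0 = 0"
  using norm_wave[OF integral_vec_0, of 0] by simp

lemma wave_diff: "integral_vec k \<Longrightarrow> wave k v - wave k w = wave k (v - w)"
  using wave_add[of k "v - w" w] by (simp add: algebra_simps)

lemma dirac_symbol_add: "dirac_symbol p k (v + w) = dirac_symbol p k v + dirac_symbol p k w"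
  by (simp add: dirac_symbol_def clifford_sum_add)

lemma dirac_symbol_smult: "dirac_symbol p k (c *s v) = c *s dirac_symbol p k v"
  by (simp add: dirac_symbol_def clifford_sum_smult)

lemma dirac_symbol_0: "dirac_symbol p k 0 = 0"
  using dirac_symbol_smult[of p k 0 0] by simp

lemma dirac_symbol_add_vec: "dirac_symbol p (k + l) v = dirac_symbol p k v + dirac_symbol p l v"
  by (simp add: dirac_symbol_def clifford_sum_def symbol_coeff_def distrib_left vector_sadd_rdistrib sum.distrib)

lemma dirac_symbol_scaleR_vec: "dirac_symbol p (r *\<^sub>R k) v = complex_of_real r *s dirac_symbol p k v"
  by (simp add: dirac_symbol_def clifford_sum_def symbol_coeff_def smult_sum_right vector_smult_assoc mult_ac)

lemma dirac_symbol_uminus_vec: "dirac_symbol p (- k) v = - dirac_symbol p k v"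
  using dirac_symbol_scaleR_vec[of p "- 1" k v] by (simp add: vector_sneg_minus1[symmetric])

lemma resolvent_wave:
  assumes "integral_vec k"
  shows "(wave k v, wave k (l *s v - dirac_symbol p k v)) \<in> resolvent_op l (dirac p)"
  using wave_in_dirac[OF assms, of v p] assms
  by (auto simp: resolvent_op_def scaleC_wave wave_diff intro!: exI[of _ "wave k v"] exI[of _ "wave k (dirac_symbol p k v)"])

lemma resolvent_symbol_mult:
  "l *s (l *s v + dirac_symbol p k v) - dirac_symbol p k (l *s v + dirac_symbol p k v) =
    (l\<^sup>2 - complex_of_real (pq_form p k k)) *s v"
  by (simp add: dirac_symbol_add dirac_symbol_smult dirac_symbol_square vector_add_ldistrib
      vector_smult_assoc power2_eq_square vec.scale_left_diff_distrib)

lemma dirac_symbol_adj_add: "dirac_symbol_adj p k (v + w) = dirac_symbol_adj p k v + dirac_symbol_adj p k w"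
  by (simp add: dirac_symbol_adj_def clifford_sum_add)

lemma dirac_symbol_adj_smult: "dirac_symbol_adj p k (c *s v) = c *s dirac_symbol_adj p k v"
  by (simp add: dirac_symbol_adj_def clifford_sum_smult)

lemma resolvent_symbol_adj_mult:
  "l *s (l *s v + dirac_symbol_adj p k v) - dirac_symbol_adj p k (l *s v + dirac_symbol_adj p k v) =
    (l\<^sup>2 - complex_of_real (pq_form p k k)) *s v"
  by (simp add: dirac_symbol_adj_add dirac_symbol_adj_smult dirac_symbol_adj_square vector_add_ldistrib
      vector_smult_assoc power2_eq_square vec.scale_left_diff_distrib)

lemma zero_in_ker_resolvent: "0 \<in> ker_op (resolvent_op l (dirac p))"
  using resolvent_wave[OF integral_vec_0, of 0 l p] by (simp add: ker_op_def wave_0 dirac_symbol_0)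

lemma exists_nonzero_spinor: "\<exists>v :: 'n spinor. v \<noteq> 0"
  by (rule exI[of _ "\<chi> a. 1"]) (simp add: vec_eq_iff)

lemma ker_resolvent_dirac_nonzero:
  fixes k :: "real^'n::{finite,linorder}"
  assumes k: "integral_vec k" and l: "l\<^sup>2 = complex_of_real (pq_form p k k)"
  shows "ker_op (resolvent_op l (dirac p :: 'n L2_spinor operator)) \<noteq> {0}"
proof -
  obtain v :: "'n spinor" where v: "v \<noteq> 0" using exists_nonzero_spinor by blast
  have "\<exists>(k' :: real^'n::{finite,linorder}) w. integral_vec k' \<and> w \<noteq> 0 \<and> l *s w - dirac_symbol p k' w = 0"
  \<comment> \<open>The factorization sends \<open>v\<close> to an eigenvector at \<open>k\<close>
    unless \<open>l + M k\<close> already kills it; then \<open>v\<close> itself is an eigenvector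
    at \<open>- k\<close>.\<close>
  proof (cases "l *s v + dirac_symbol p k v = 0")
    case True
    then have "l *s v - dirac_symbol p (- k) v = 0" by (simp add: dirac_symbol_uminus_vec)
    then show ?thesis using v integral_vec_minus[OF k] by blast
  next
    case False
    moreover have "l *s (l *s v + dirac_symbol p k v) - dirac_symbol p k (l *s v + dirac_symbol p k v) = 0"
      unfolding resolvent_symbol_mult l by simp
    ultimately show ?thesis using k by blast
  qed
  then obtain k' :: "real^'n::{finite,linorder}" and w where w: "integral_vec k'" "w \<noteq> 0" "l *s w - dirac_symbol p k' w = 0" by blast
  have "wave k' 0 = 0" using norm_wave[OF w(1), of 0] by simp
  then have "wave k' w \<in> ker_op (resolvent_op l (dirac p))"
    using resolvent_wave[OF w(1), of w l p] w(3) by (simp add: ker_op_def)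
  moreover have "wave k' w \<noteq> 0" using norm_wave[OF w(1), of w] w(2) by auto
  ultimately show ?thesis by blast
qed

text \<open>Both sides are continuous on the product space, so the identity cuts out a closed set
  that contains the graph.\<close>

lemma closure_dirac_inner_wave:
  assumes "(x, y) \<in> closure (dirac p)" "integral_vec k"
  shows "inner y (wave k w) = inner x (wave k (dirac_symbol_adj p k w))"
proof -
  have "closure (dirac p) \<subseteq> {z. inner (snd z) (wave k w) = inner (fst z) (wave k (dirac_symbol_adj p k w))}"
    using dirac_inner_wave[OF _ assms(2)] by (intro closure_minimal closed_Collect_eq continuous_intros) auto
  then show ?thesis using assms(1) by auto
qed

text \<open>A kernel vector is orthogonal to every wave whose amplitude lies in the range of
  \<open>cnj l\<close> minus the adjoint symbol. That range contains all amplitudes, so the vector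
  is orthogonal to a dense set.\<close>

lemma ker_resolvent_closure_dirac:
  fixes p :: nat and l :: complex
  assumes l: "\<And>k :: real^'n::{finite,linorder}. integral_vec k \<Longrightarrow> l\<^sup>2 \<noteq> complex_of_real (pq_form p k k)"
  shows "ker_op (resolvent_op l (closure (dirac p :: 'n L2_spinor operator))) \<subseteq> {0}"
proof
  fix x :: "'n L2_spinor" assume "x \<in> ker_op (resolvent_op l (closure (dirac p)))"
  then have x: "(x, scaleC l x) \<in> closure (dirac p)" by (auto simp: ker_op_def resolvent_op_def)
  have ortho: "inner x (wave k v) = 0" if k: "integral_vec k" for k v
  proof -
    \<comment> \<open>The conjugate of \<open>l\<close> arises from moving \<open>l\<close> to the
      second argument. As the form is real, \<open>c\<close> is the conjugate of the nonzero number
      in the hypothesis.\<close>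
    define c where "c = (cnj l)\<^sup>2 - complex_of_real (pq_form p k k)"
    define u where "u = inverse c *s v"
    define w where "w = cnj l *s u + dirac_symbol_adj p k u"
    have "c = cnj (l\<^sup>2 - complex_of_real (pq_form p k k))" by (simp add: c_def)
    then have c: "c \<noteq> 0" using l[OF k] by (metis complex_cnj_zero_iff right_minus_eq)
    have "cnj l *s w - dirac_symbol_adj p k w = c *s u"
      unfolding w_def c_def by (rule resolvent_symbol_adj_mult)
    also have "\<dots> = v" using c by (simp add: u_def vector_smult_assoc)
    finally have v: "cnj l *s w - dirac_symbol_adj p k w = v" .
    have "inner x (scaleC (cnj l) (wave k w)) = inner x (wave k (dirac_symbol_adj p k w))"
      using closure_dirac_inner_wave[OF x k] by (simp add: inner_scaleC_left)
    then have "inner x (scaleC (cnj l) (wave k w) - wave k (dirac_symbol_adj p k w)) = 0"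
      by (simp add: inner_diff_right)
    then show ?thesis by (simp add: scaleC_wave k wave_diff v)
  qed
  have "closure {y. inner x y = 0} = UNIV"
    by (rule wave_span_dense) (auto simp: ortho inner_add_right)
  moreover have "closed {y. inner x y = 0}"
    by (intro closed_Collect_eq continuous_intros)
  \<comment> \<open>The orthogonal complement of \<open>x\<close> is closed and dense, hence
    contains \<open>x\<close> itself.\<close>
  ultimately have "x \<in> {y. inner x y = 0}" by (metis UNIV_I closure_closed)
  then show "x \<in> {0}" by simp
qed

lemma closure_Range_resolvent_dirac:
  fixes p :: nat and l :: complex
  assumes l: "\<And>k :: real^'n::{finite,linorder}. integral_vec k \<Longrightarrow> l\<^sup>2 \<noteq> complex_of_real (pq_form p k k)"
  shows "closure (Range (resolvent_op l (dirac p :: 'n L2_spinor operator))) = UNIV"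
proof (rule wave_span_dense)
  fix k :: "real^'n::{finite,linorder}" and v :: "'n spinor" assume k: "integral_vec k"
  define c where "c = l\<^sup>2 - complex_of_real (pq_form p k k)"
  \<comment> \<open>With this scaling the other factor \<open>l + M k\<close> maps \<open>u\<close>
    to the amplitude of a preimage of the wave.\<close>
  define u where "u = inverse c *s v"
  have "c \<noteq> 0" using l[OF k] by (simp add: c_def)
  then have "l *s (l *s u + dirac_symbol p k u) - dirac_symbol p k (l *s u + dirac_symbol p k u) = v"
    unfolding resolvent_symbol_mult c_def[symmetric] by (simp add: u_def vector_smult_assoc)
  then show "wave k v \<in> Range (resolvent_op l (dirac p))"
    using resolvent_wave[OF k, of "l *s u + dirac_symbol p k u" l p] by (auto intro: RangeI)
next
  fix x y :: "'n L2_spinor"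
  assume "x \<in> Range (resolvent_op l (dirac p))" "y \<in> Range (resolvent_op l (dirac p))"
  then obtain a b a' b' where "(a, b) \<in> dirac p" "(a', b') \<in> dirac p" "x = scaleC l a - b" "y = scaleC l a' - b'"
    by (auto simp: resolvent_op_def)
  then have "(a + a', x + y) \<in> resolvent_op l (dirac p)"
    using dirac_add[of a b p a' b'] by (force simp: resolvent_op_def scaleC_add_right algebra_simps)
  then show "x + y \<in> Range (resolvent_op l (dirac p))" by blast
qed

section \<open>Null vectors and unboundedness of the resolvent\<close>

lemma exists_pos_le_less:
  assumes "0 < p" "p < CARD('n::{finite,linorder})"
  obtains a b :: "'n::{finite,linorder}" where "pos a \<le> p" "p < pos b"
proof
  \<comment> \<open>The smallest index has position 1, the largest has position n; the bounds on
    \<open>p\<close> separate them.\<close>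
  have "{k. k \<le> Min UNIV} = {Min (UNIV :: 'n set)}" by (auto intro: antisym)
  then show "pos (Min UNIV :: 'n) \<le> p" using assms by (simp add: pos_def)
  have "{k. k \<le> Max UNIV} = (UNIV :: 'n set)" by auto
  then show "p < pos (Max UNIV :: 'n)" using assms by (simp add: pos_def)
qed

lemma pq_form_two_axes:
  fixes a b :: "'n::{finite,linorder}"
  assumes "pos a \<le> p" "p < pos b"
  defines "k \<equiv> \<lambda>s t. s *\<^sub>R axis a 1 + t *\<^sub>R axis b 1 :: real^'n::{finite,linorder}"
  shows "pq_form p (k s t) (k s t) = t\<^sup>2 - s\<^sup>2"
proof -
  have "a \<noteq> b" using assms by auto
  then have "pq_form p (k s t) (k s t) = (\<Sum>j\<in>UNIV. (if j = a then - s\<^sup>2 else 0) + (if j = b then t\<^sup>2 else 0))"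
    unfolding pq_form_eq using assms by (intro sum.cong) (auto simp: axis_def metric_sign_def power2_eq_square)
  then show ?thesis by (simp add: sum.distrib)
qed

text \<open>On the null vector \<open>k\<close> the symbol is nilpotent but nonzero, so along its multiples the inverse of
  \<open>l - dirac_symbol p (t *\<^sub>R k)\<close>, which is \<open>(l + t * dirac_symbol p k) / l\<^sup>2\<close>, grows linearly in \<open>t\<close>.\<close>

lemma resolvent_inverse_unbounded:
  fixes A :: "'n::{finite,linorder} L2_spinor operator"
  assumes p: "0 < p" "p < CARD('n)" and A: "dirac p \<subseteq> A"
  shows "\<not> bounded_op ((resolvent_op l A)\<inverse>)"
proof
  assume "bounded_op ((resolvent_op l A)\<inverse>)"
  then obtain C where C: "\<And>x y. (x, y) \<in> resolvent_op l A \<Longrightarrow> norm x \<le> C * norm y"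
    by (auto simp: bounded_op_def)
  obtain a b :: 'n where ab: "pos a \<le> p" "p < pos b" using exists_pos_le_less[OF p] .
  define k :: "real^'n::{finite,linorder}" where "k = axis a 1 + axis b 1"
  have null: "pq_form p (t *\<^sub>R k) (t *\<^sub>R k) = 0" for t
    using pq_form_two_axes[OF ab, of t t] by (simp add: k_def scaleR_add_right)
  have "\<exists>v. dirac_symbol p k v \<noteq> 0"
  proof (rule ccontr)
    \<comment> \<open>If the symbol vanished at \<open>k\<close>, adding \<open>k\<close> to the
      time-like axis would leave its symbol unchanged; but the squares of the two symbols are -3 and
      -1.\<close>
    assume "\<not> ?thesis"
    then have eq: "dirac_symbol p (k + axis a 1) = dirac_symbol p (axis a 1)"
      by (auto simp: dirac_symbol_add_vec)
    obtain v :: "'n spinor" where v: "v \<noteq> 0" using exists_nonzero_spinor by blast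
    have "complex_of_real (pq_form p (k + axis a 1) (k + axis a 1)) *s v =
        complex_of_real (pq_form p (axis a 1) (axis a 1)) *s v"
      unfolding dirac_symbol_square[symmetric] eq ..
    moreover have "pq_form p (k + axis a 1) (k + axis a 1) = - 3"
      using pq_form_two_axes[OF ab, of 2 1] by (simp add: k_def scaleR_2 algebra_simps)
    moreover have "pq_form p (axis a 1) (axis a 1) = - 1"
      using ab by (simp add: pq_form_axis metric_sign_def)
    ultimately show False using v by (auto simp: vec_eq_iff)
  qed
  then obtain v where v: "dirac_symbol p k v \<noteq> 0" by blast
  \<comment> \<open>The amplitude \<open>(l + n * M k) v\<close> is sent to
    \<open>l\<^sup>2 *s v\<close>, whose norm does not depend on \<open>n\<close>. Multiplying out
    instead of dividing by the square of \<open>l\<close> includes \<open>l = 0\<close>.\<close>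
  have bound: "real n * norm (dirac_symbol p k v) \<le> C * (norm (l\<^sup>2) * norm v) + norm (l *s v)" for n
  proof -
    let ?k = "real n *\<^sub>R k"
    have k: "integral_vec ?k"
      unfolding integral_vec_def k_def by (auto simp: axis_def)
    have "(wave ?k (l *s v + dirac_symbol p ?k v), wave ?k (l\<^sup>2 *s v)) \<in> resolvent_op l (dirac p)"
      using resolvent_wave[OF k, of "l *s v + dirac_symbol p ?k v" l p]
      unfolding resolvent_symbol_mult null by simp
    then have "(wave ?k (l *s v + dirac_symbol p ?k v), wave ?k (l\<^sup>2 *s v)) \<in> resolvent_op l A"
      using A by (auto simp: resolvent_op_def)
    from C[OF this] have "norm (l *s v + real n *\<^sub>R dirac_symbol p k v) \<le> C * (norm (l\<^sup>2) * norm v)"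
      by (simp add: norm_wave[OF k] norm_smult_spinor dirac_symbol_scaleR_vec scaleR_spinor)
    moreover have "norm (real n *\<^sub>R dirac_symbol p k v) \<le> norm (l *s v + real n *\<^sub>R dirac_symbol p k v) + norm (l *s v)"
      using norm_triangle_ineq4[of "l *s v + real n *\<^sub>R dirac_symbol p k v" "l *s v"] by simp
    ultimately show ?thesis by simp
  qed
  obtain n :: nat where "C * (norm (l\<^sup>2) * norm v) + norm (l *s v) < real n * norm (dirac_symbol p k v)"
    using reals_Archimedean3[of "norm (dirac_symbol p k v)"] v by auto
  with bound[of n] show False by simp
qed

theorem theorem5p9:
  fixes p q :: nat
    and D :: "'n::{finite,linorder} L2_spinor operator"
  assumes "CARD('n) = p + q" and "CARD('n) \<ge> 2" and "0 < p" and "p < CARD('n)"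
    and "D = dirac p"
  shows "spectrum D = UNIV \<and> spectrum (closure D) = UNIV \<and>
    continuous_spectrum (closure D) \<union> point_spectrum (closure D) = UNIV \<and>
    point_spectrum (closure D) = point_spectrum D \<and>
    point_spectrum D =
      {l. \<exists>k :: real^'n::{finite,linorder}. (\<forall>i. k $ i \<in> \<int>) \<and>
        (l = csqrt (complex_of_real (pq_form p k k)) \<or> l = - csqrt (complex_of_real (pq_form p k k)))}"
proof -
  let ?L = "{l. \<exists>k :: real^'n::{finite,linorder}. (\<forall>i. k $ i \<in> \<int>) \<and>
        (l = csqrt (complex_of_real (pq_form p k k)) \<or> l = - csqrt (complex_of_real (pq_form p k k)))}"
  \<comment> \<open>Passing to the squared equation removes the branch of the root and matches the
    form in which the symbols are factorized.\<close>
  have "l = csqrt z \<or> l = - csqrt z \<longleftrightarrow> l\<^sup>2 = z" for l z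
    by (metis power2_csqrt power2_eq_iff)
  then have L: "?L = {l. \<exists>k :: real^'n::{finite,linorder}. integral_vec k \<and> l\<^sup>2 = complex_of_real (pq_form p k k)}"
    by (simp add: integral_vec_def)
  have sub: "D \<subseteq> closure D" by (rule closure_subset)
  have mono: "resolvent_op l D \<subseteq> resolvent_op l (closure D)" for l
    using sub by (auto simp: resolvent_op_def)
  have ker_mono: "ker_op (resolvent_op l D) \<subseteq> ker_op (resolvent_op l (closure D))" for l
    using mono[of l] by (auto simp: ker_op_def)
  have ker0: "0 \<in> ker_op (resolvent_op l D)" for l
    using assms(5) zero_in_ker_resolvent by simp
  \<comment> \<open>Start of a circle of three inclusions, through the point spectrum of the closure
    and back to \<open>?L\<close>, which gives both equalities at once.\<close>
  have "?L \<subseteq> point_spectrum D"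
    unfolding L point_spectrum_def assms(5) using ker_resolvent_dirac_nonzero by auto
  moreover have "point_spectrum D \<subseteq> point_spectrum (closure D)"
    using ker_mono ker0 unfolding point_spectrum_def by blast
  moreover have ker_closure: "ker_op (resolvent_op l (closure D)) = {0}" if "l \<notin> ?L" for l
    using ker_resolvent_closure_dirac[of l p] that ker_mono[of l] ker0[of l] unfolding L assms(5) by blast
  then have "point_spectrum (closure D) \<subseteq> ?L"
    unfolding point_spectrum_def by blast
  ultimately have point: "point_spectrum D = ?L" "point_spectrum (closure D) = ?L" by blast+
  have unbounded: "\<not> bounded_op ((resolvent_op l D)\<inverse>)" "\<not> bounded_op ((resolvent_op l (closure D))\<inverse>)" for l
    using resolvent_inverse_unbounded[OF assms(3,4)] sub assms(5) by auto
  \<comment> \<open>Density of the range, inherited from \<open>D\<close>, is what rules out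
    residual spectrum of the closure.\<close>
  have "l \<in> continuous_spectrum (closure D)" if "l \<notin> ?L" for l
  proof -
    have "closure (Range (resolvent_op l D)) = UNIV"
      using closure_Range_resolvent_dirac[of l p] that unfolding L assms(5) by blast
    moreover have "closure (Range (resolvent_op l D)) \<subseteq> closure (Range (resolvent_op l (closure D)))"
      using mono[of l] by (intro closure_mono Range_mono)
    ultimately show ?thesis
      using ker_closure[OF that] unbounded(2) by (auto simp: continuous_spectrum_def)
  qed
  then have "continuous_spectrum (closure D) \<union> point_spectrum (closure D) = UNIV"
    unfolding point by blast
  moreover have "spectrum D = UNIV" "spectrum (closure D) = UNIV"
    using unbounded by (auto simp: spectrum_def resolvent_set_def)
  ultimately show ?thesis using point by simp
qed

end
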